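(* As formal power series in $t$, $$S(t) = t - \frac{2t^2}{1+t} - F^{\langle -1\rangle}(t).$$
   Context: A block of a permutation $\pi$ of $\{1,\ldots,n\}$ is a nonempty set of consecutive positions whose set of values under $\pi$ is a set of consecutive integers. A permutation of length $n$ is simple if its only blocks are the singletons and $\{1,\ldots,n\}$. Let $s_n$ be the number of simple permutations of length $n$. Define the formal power series $$F(x)=\sum_{k=1}^{\infty} k!\,x^k, \qquad S(x)=\sum_{k=4}^{\infty} s_k x^k.$$ $F^{\langle -1\rangle}$ denotes the compositional (functional) inverse of $F$, i.e. the power series with zero constant term such that $F(F^{\langle -1\rangle}(t))=t$. *)

theory Defs
  imports
    "HOL-Computational_Algebra.Formal_Power_Series"
    "HOL-Combinatorics.Permutations"
begin

definition perm_block :: "nat \<Rightarrow> (nat \<Rightarrow> nat) \<Rightarrow> nat set \<Rightarrow> bool" where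
  "perm_block n p B \<longleftrightarrow>
     (\<exists>i j. 1 \<le> i \<and> i \<le> j \<and> j \<le> n \<and> B = {i..j}) \<and> (\<exists>a b. p ` B = {a..b})"

definition simple_perm :: "nat \<Rightarrow> (nat \<Rightarrow> nat) \<Rightarrow> bool" where
  "simple_perm n p \<longleftrightarrow>
     p permutes {1..n} \<and> (\<forall>B. perm_block n p B \<longrightarrow> (\<exists>i. B = {i}) \<or> B = {1..n})"

definition num_simple :: "nat \<Rightarrow> nat" where
  "num_simple n = card {p. simple_perm n p}"

(* Both series have integer coefficients; they are taken over the rationals because
   the library's compositional inverse fps_inv is defined over fields only. *)

definition fact_series :: "rat fps" where
  "fact_series = Abs_fps (\<lambda>k. if k = 0 then 0 else fact k)"

definition simple_series :: "rat fps" where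
  "simple_series = Abs_fps (\<lambda>k. if k \<ge> 4 then of_nat (num_simple k) else 0)"

(* fps_inv is total; the next two facts confirm that fps_inv fact_series is
   the compositional inverse with zero constant term, and that this is unique. *)

lemma fact_series_inv:
  "fps_nth (fps_inv fact_series) 0 = 0"
  "fact_series oo fps_inv fact_series = fps_X"
proof -
  show "fps_nth (fps_inv fact_series) 0 = 0"
    by (simp add: fps_inv_def)
  show "fact_series oo fps_inv fact_series = fps_X"
    by (rule fps_inv_right) (simp_all add: fact_series_def)
qed

lemma fact_series_inv_unique:
  assumes "fps_nth g 0 = 0" and "fact_series oo g = fps_X"
  shows "g = fps_inv fact_series"
proof -
  have "fps_inv fact_series oo (fact_series oo g) = (fps_inv fact_series oo fact_series) oo g"
    by (rule fps_compose_assoc) (simp_all add: fact_series_def assms(1))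
  moreover have "fps_inv fact_series oo fact_series = fps_X"
    by (rule fps_inv) (simp_all add: fact_series_def)
  ultimately show ?thesis
    by (simp add: assms)
qed

end

theory Submission
  imports Defs
begin

text \<open>
  Write \<open>X\<close> for the variable, \<open>F\<close> for the series of all permutations and \<open>S\<close> for that of the simple ones.
  Composing with \<open>F\<close> on the right turns the claim into \<open>F = X + 2 F^2 / (1 + F) + S(F)\<close>, and this
  equation (\<open>fact_series_decomposition\<close>) sorts the permutations by shape.

  The term \<open>X\<close> is the permutation of length 1. The middle term stands for the permutations that split, which
  means that some block has a block as its complement; they are the direct sums and the skew sums. Every
  nonempty permutation is uniquely an indecomposable one followed by an arbitrary, possibly empty, one, so the
  series \<open>A\<close> of the indecomposable permutations satisfies \<open>A (1 + F) = F\<close> (\<open>indec_series_eq\<close>). The direct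
  sums therefore have the series \<open>F - A = F^2 / (1 + F)\<close>. Reversing the values turns them into the skew sums,
  and no permutation is both (\<open>card_splits\<close>).

  Now let \<open>p\<close> be a permutation of length at least 2 that does not split. Two overlapping proper blocks
  cannot cover everything, so their union is again a proper block, and lying in a common proper block is
  an equivalence relation. Its classes are intervals of positions whose values form intervals, and
  collapsing each class to a point yields a simple permutation, whose length turns out to be at least 4
  (\<open>inflation_exists\<close>). Conversely, in an inflation of such a simple permutation every proper block stays inside one part
  (\<open>inflation_proper_block\<close>), so the parts and the simple permutation can be read off
  (\<open>inflation_unique\<close>). A simple permutation of length \<open>k\<close> and a partition of the positions into \<open>k\<close>
  intervals have as many inflations as the product of the factorials of the part sizes
  (\<open>card_inflations\<close>), and summing this over the partitions gives the coefficients of \<open>F^k\<close>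
  (\<open>fact_series_power_nth\<close>). Together these are the coefficients of \<open>S(F)\<close>.
\<close>

section \<open>Order convex sets and blocks\<close>

text \<open>A nonempty finite set of naturals is an interval iff it is order convex. Convexity of
unions and preimages can be shown without naming end points, for positions and values alike.\<close>

definition ord_convex :: "nat set \<Rightarrow> bool" where
  "ord_convex S \<longleftrightarrow> (\<forall>x\<in>S. \<forall>y\<in>S. \<forall>z. x \<le> z \<longrightarrow> z \<le> y \<longrightarrow> z \<in> S)"

lemma ord_convexD: "ord_convex S \<Longrightarrow> x \<in> S \<Longrightarrow> y \<in> S \<Longrightarrow> x \<le> z \<Longrightarrow> z \<le> y \<Longrightarrow> z \<in> S"
  unfolding ord_convex_def by meson

lemma ord_convex_atLeastAtMost: "ord_convex {a..b}"
  unfolding ord_convex_def by (meson atLeastAtMost_iff order_trans)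

lemma ord_convex_iff_interval:
  assumes "finite S" "S \<noteq> {}"
  shows "ord_convex S \<longleftrightarrow> (\<exists>a b. S = {a..b})"
proof
  assume cv: "ord_convex S"
  have "S = {Min S..Max S}"
  proof
    show "S \<subseteq> {Min S..Max S}" using assms by auto
    show "{Min S..Max S} \<subseteq> S"
    proof
      fix z assume "z \<in> {Min S..Max S}"
      then have "Min S \<le> z" "z \<le> Max S" by simp_all
      then show "z \<in> S" by (rule ord_convexD[OF cv Min_in[OF assms] Max_in[OF assms]])
    qed
  qed
  then show "\<exists>a b. S = {a..b}" by blast
next
  assume "\<exists>a b. S = {a..b}"
  then obtain a b where "S = {a..b}" by blast
  then show "ord_convex S" by (simp add: ord_convex_atLeastAtMost)
qed

lemma ord_convex_Un:
  assumes "ord_convex A" "ord_convex B" "x \<in> A" "x \<in> B"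
  shows "ord_convex (A \<union> B)"
  unfolding ord_convex_def
proof (intro ballI allI impI)
  fix u v z assume u: "u \<in> A \<union> B" and v: "v \<in> A \<union> B" and le: "u \<le> z" "z \<le> v"
  show "z \<in> A \<union> B"
  proof (cases "z \<le> x")
    case True
    from u show ?thesis
      using ord_convexD[OF assms(1) _ assms(3) le(1) True]
        ord_convexD[OF assms(2) _ assms(4) le(1) True] by blast
  next
    case False
    then have "x \<le> z" by simp
    from v show ?thesis
      using ord_convexD[OF assms(1) assms(3) _ \<open>x \<le> z\<close> le(2)]
        ord_convexD[OF assms(2) assms(4) _ \<open>x \<le> z\<close> le(2)] by blast
  qed
qed

text \<open>As \<open>A\<close> is a proper convex subset it misses one end of \<open>{1..n}\<close>. That end lies in \<open>B\<close>, so \<open>B\<close> reaches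
to it, and what remains is a segment at the other end.\<close>

lemma ord_convex_complement:
  assumes "ord_convex A" "ord_convex B" "A \<union> B = {1..n}" "A \<noteq> {1..n}"
  shows "ord_convex ({1..n} - B)"
proof (cases "n = 0")
  case False
  then have n: "1 \<in> {1..n}" "n \<in> {1..n}" by auto
  have "\<not> (1 \<in> A \<and> n \<in> A)"
  proof
    assume *: "1 \<in> A \<and> n \<in> A"
    have "z \<in> A" if "z \<in> {1..n}" for z
      using ord_convexD[OF assms(1), of 1 n z] * that by simp
    with assms(3,4) show False by blast
  qed
  then have B: "1 \<in> B \<or> n \<in> B" using assms(3) n by blast
  show ?thesis
    unfolding ord_convex_def
  proof (intro ballI allI impI)
    fix x y z assume x: "x \<in> {1..n} - B" and y: "y \<in> {1..n} - B" and le: "x \<le> z" "z \<le> y"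
    have z: "z \<in> {1..n}" using x y le by simp
    have "z \<notin> B"
    proof
      assume "z \<in> B"
      from B show False
      proof
        assume "1 \<in> B"
        then have "x \<in> B" using ord_convexD[OF assms(2) \<open>1 \<in> B\<close> \<open>z \<in> B\<close>, of x] x le by simp
        then show False using x by blast
      next
        assume "n \<in> B"
        then have "y \<in> B" using ord_convexD[OF assms(2) \<open>z \<in> B\<close> \<open>n \<in> B\<close>, of y] y le by simp
        then show False using y by blast
      qed
    qed
    then show "z \<in> {1..n} - B" using z by blast
  qed
qed (simp add: ord_convex_def)

lemma ord_convex_initial:
  assumes "ord_convex S" "S \<subseteq> {1..n}" "1 \<in> S"
  shows "S = {1..card S}"
proof -
  have fin: "finite S" using assms(2) finite_subset by blast
  have ne: "S \<noteq> {}" using assms(3) by blast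
  then obtain a b where ab: "S = {a..b}"
    using assms(1) ord_convex_iff_interval[OF fin] by blast
  then have "a = 1" using assms(2,3) ne by auto
  then show ?thesis using ab by simp
qed

lemma perm_block_iff:
  assumes "p permutes {1..n}"
  shows "perm_block n p B \<longleftrightarrow> B \<noteq> {} \<and> B \<subseteq> {1..n} \<and> ord_convex B \<and> ord_convex (p ` B)"
    (is "_ \<longleftrightarrow> ?R")
proof
  assume "perm_block n p B"
  then obtain i j a b where "1 \<le> i" "i \<le> j" "j \<le> n" "B = {i..j}" "p ` B = {a..b}"
    unfolding perm_block_def by blast
  then show ?R by (simp add: ord_convex_atLeastAtMost)
next
  assume R: ?R
  then have fin: "finite B" using finite_subset by blast
  obtain i j where ij: "B = {i..j}" using R ord_convex_iff_interval[OF fin] by blast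
  obtain a b where "p ` B = {a..b}" using R ord_convex_iff_interval[of "p ` B"] fin by blast
  moreover have "1 \<le> i" "i \<le> j" "j \<le> n" using R ij by auto
  ultimately show "perm_block n p B" unfolding perm_block_def using ij by blast
qed

lemma perm_block_singleton:
  assumes "p permutes {1..n}" "x \<in> {1..n}"
  shows "perm_block n p {x}"
proof -
  have "ord_convex {j}" for j using ord_convex_atLeastAtMost[of j j] by simp
  then show ?thesis unfolding perm_block_iff[OF assms(1)] using assms(2) by simp
qed

lemma permutes_image_subset: "p permutes A \<Longrightarrow> B \<subseteq> A \<Longrightarrow> p ` B \<subseteq> A"
  using permutes_image by blast

lemma permutes_image_diff: "p permutes A \<Longrightarrow> p ` (A - B) = A - p ` B"
  by (simp add: image_set_diff permutes_image permutes_inj)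

section \<open>Interval partitions as monotone surjections\<close>

text \<open>A partition of the positions into \<open>k\<close> consecutive intervals is encoded by the map sending a position to
the index of its interval. Extensionality makes distinct partitions and distinct maps correspond.\<close>

definition staircases :: "nat \<Rightarrow> nat \<Rightarrow> (nat \<Rightarrow> nat) set" where
  "staircases n k = {c \<in> {1..n} \<rightarrow>\<^sub>E {1..k}. mono_on {1..n} c \<and> c ` {1..n} = {1..k}}"

definition fibre :: "nat \<Rightarrow> (nat \<Rightarrow> nat) \<Rightarrow> nat \<Rightarrow> nat set" where
  "fibre n c j = {x \<in> {1..n}. c x = j}"

lemma finite_staircases: "finite (staircases n k)"
  unfolding staircases_def
  by (rule finite_subset[of _ "{1..n} \<rightarrow>\<^sub>E {1..k}"]) (auto intro: finite_PiE)

lemma staircasesD: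
  assumes "c \<in> staircases n k"
  shows "c ` {1..n} = {1..k}"
    and "\<And>x y. x \<in> {1..n} \<Longrightarrow> y \<in> {1..n} \<Longrightarrow> x \<le> y \<Longrightarrow> c x \<le> c y"
    and "\<And>x. x \<in> {1..n} \<Longrightarrow> c x \<in> {1..k}"
    and "\<And>x y. x \<in> {1..n} \<Longrightarrow> y \<in> {1..n} \<Longrightarrow> c x < c y \<Longrightarrow> x < y"
    and "\<And>j. j \<in> {1..k} \<Longrightarrow> \<exists>x\<in>{1..n}. c x = j"
    and "\<And>x. x \<notin> {1..n} \<Longrightarrow> c x = undefined"
proof -
  show *: "\<And>x y. x \<in> {1..n} \<Longrightarrow> y \<in> {1..n} \<Longrightarrow> x \<le> y \<Longrightarrow> c x \<le> c y"
    using assms unfolding staircases_def mono_on_def by simp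
  show "\<And>x y. x \<in> {1..n} \<Longrightarrow> y \<in> {1..n} \<Longrightarrow> c x < c y \<Longrightarrow> x < y"
    using * by (meson leD leI)
  show im: "c ` {1..n} = {1..k}" using assms by (simp add: staircases_def)
  show "\<And>x. x \<in> {1..n} \<Longrightarrow> c x \<in> {1..k}" using im by blast
  show "\<And>j. j \<in> {1..k} \<Longrightarrow> \<exists>x\<in>{1..n}. c x = j" unfolding im[symmetric] by auto
  show "\<And>x. x \<notin> {1..n} \<Longrightarrow> c x = undefined"
  proof -
    have "c \<in> {1..n} \<rightarrow>\<^sub>E {1..k}" using assms by (simp add: staircases_def)
    then show "c x = undefined" if "x \<notin> {1..n}" for x using that by (rule PiE_arb)
  qed
qed

lemma staircase_start:
  assumes c: "c \<in> staircases n k" and "1 \<le> n"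
  shows "c 1 = 1"
proof -
  have "c 1 \<in> {1..k}" using staircasesD(3)[OF c, of 1] assms(2) by simp
  then obtain x where x: "x \<in> {1..n}" "c x = 1" using staircasesD(5)[OF c, of 1] by auto
  then have "c 1 \<le> c x" using staircasesD(2)[OF c, of 1 x] assms by auto
  then show ?thesis using x \<open>c 1 \<in> _\<close> by simp
qed

lemma staircase_step:
  assumes c: "c \<in> staircases n k" and x: "1 \<le> x" "Suc x \<le> n" and ne: "c (Suc x) \<noteq> c x"
  shows "c (Suc x) = Suc (c x)"
proof (rule ccontr)
  assume ne2: "c (Suc x) \<noteq> Suc (c x)"
  have le: "c x \<le> c (Suc x)" using staircasesD(2)[OF c, of x "Suc x"] x by simp
  have "c (Suc x) \<in> {1..k}" using staircasesD(3)[OF c, of "Suc x"] x by simp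
  then have "Suc (c x) \<in> {1..k}" using le ne by auto
  then obtain y where y: "y \<in> {1..n}" "c y = Suc (c x)" using staircasesD(5)[OF c] by blast
  have "x < y" using staircasesD(4)[OF c, of x y] x y by auto
  moreover have "y < Suc x" using staircasesD(4)[OF c, of y "Suc x"] x y le ne ne2 by auto
  ultimately show False by simp
qed

text \<open>A staircase starts at 1 and rises by at most one, exactly where neighbouring positions are separated, so
its kernel determines it, together with its height.\<close>

lemma staircase_eqI:
  assumes c: "c \<in> staircases n k" and d: "d \<in> staircases n l"
    and ker: "\<And>x y. x \<in> {1..n} \<Longrightarrow> y \<in> {1..n} \<Longrightarrow> c x = c y \<longleftrightarrow> d x = d y"
  shows "c = d \<and> k = l"
proof -
  have eq: "1 \<le> x \<Longrightarrow> x \<le> n \<Longrightarrow> c x = d x" for x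
  proof (induction x rule: nat_induct)
    case (Suc x)
    show ?case
    proof (cases "x = 0")
      case True
      then show ?thesis using staircase_start[OF c] staircase_start[OF d] Suc by simp
    next
      case False
      then have IH: "c x = d x" and x: "1 \<le> x" using Suc by auto
      show ?thesis
        using staircase_step[OF c x Suc.prems(2)] staircase_step[OF d x Suc.prems(2)]
          ker[of "Suc x" x] IH x Suc.prems by auto
    qed
  qed simp
  have "c = d"
  proof
    fix x show "c x = d x"
      using eq[of x] staircasesD(6)[OF c, of x] staircasesD(6)[OF d, of x] by (cases "x \<in> {1..n}") auto
  qed
  moreover have "{1..k} = {1..l}"
    using eq staircasesD(1)[OF c] staircasesD(1)[OF d] by (metis \<open>c = d\<close>)
  then have "k = l" by (metis card_atLeastAtMost diff_Suc_1)
  ultimately show ?thesis by blast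
qed

text \<open>The staircase with a prescribed kernel counts the positions up to \<open>x\<close> that are not related to their
predecessor. Position 1 counts because 0 is related to nothing.\<close>

lemma staircase_exists:
  fixes R :: "nat \<Rightarrow> nat \<Rightarrow> bool"
  assumes refl: "\<And>x. x \<in> {1..n} \<Longrightarrow> R x x"
    and sym: "\<And>x y. R x y \<Longrightarrow> R y x"
    and trans: "\<And>x y z. R x y \<Longrightarrow> R y z \<Longrightarrow> R x z"
    and dom: "\<And>x y. R x y \<Longrightarrow> x \<in> {1..n}"
    and conv: "\<And>x y z. R x y \<Longrightarrow> x \<le> z \<Longrightarrow> z \<le> y \<Longrightarrow> R x z"
  shows "\<exists>k. \<exists>c\<in>staircases n k. \<forall>x\<in>{1..n}. \<forall>y\<in>{1..n}. c x = c y \<longleftrightarrow> R x y"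
proof -
  define d where "d x = card {z \<in> {1..x}. \<not> R (z - 1) z}" for x
  have dSuc: "d (Suc x) = (if R x (Suc x) then d x else Suc (d x))" for x
  proof -
    have "{z \<in> {1..Suc x}. \<not> R (z - 1) z} =
        (if R x (Suc x) then {} else {Suc x}) \<union> {z \<in> {1..x}. \<not> R (z - 1) z}"
      by (auto simp: le_Suc_eq)
    then show ?thesis by (auto simp: d_def)
  qed
  have d0: "d 0 = 0" by (simp add: d_def)
  have mono: "x \<le> y \<Longrightarrow> d x \<le> d y" for x y
    by (rule lift_Suc_mono_le[of d]) (auto simp: dSuc)
  have "R 0 1 \<Longrightarrow> False" using dom[of 0 1] by simp
  then have d1: "d (Suc 0) = 1" using dSuc[of 0] d0 by auto
  have surj: "d ` {1..m} = {1..d m}" for m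
  proof (induction m)
    case (Suc m)
    have "d ` {1..Suc m} = insert (d (Suc m)) (d ` {1..m})"
      by (simp add: atLeastAtMostSuc_conv)
    then show ?case using Suc d1 d0 by (cases "m = 0") (auto simp: dSuc le_Suc_eq)
  qed (simp add: d0)
  have ker_le: "d x = d y \<longleftrightarrow> R x y" if "x \<in> {1..n}" "x \<le> y" "y \<le> n" for x y
    using that(2,3)
  proof (induction y rule: dec_induct)
    case base then show ?case using refl that by simp
  next
    case (step y)
    have y: "y \<in> {1..n}" using step that by auto
    have "d x \<le> d y" using mono step by simp
    then have "d x = d (Suc y) \<longleftrightarrow> d x = d y \<and> R y (Suc y)"
      by (auto simp: dSuc)
    also have "\<dots> \<longleftrightarrow> R x y \<and> R y (Suc y)" using step by simp
    also have "\<dots> \<longleftrightarrow> R x (Suc y)"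
      using trans sym conv[of x "Suc y" y] step(1) by (meson le_SucI order_refl)
    finally show ?case .
  qed
  have ker: "d x = d y \<longleftrightarrow> R x y" if "x \<in> {1..n}" "y \<in> {1..n}" for x y
  proof (cases "x \<le> y")
    case True
    then show ?thesis using ker_le[of x y] that by simp
  next
    case False
    then have "d y = d x \<longleftrightarrow> R y x" using ker_le[of y x] that by simp
    then show ?thesis using sym[of x y] sym[of y x] by metis
  qed
  define c where "c = restrict d {1..n}"
  have ceq: "c x = d x" if "x \<in> {1..n}" for x using that by (simp add: c_def)
  have "c ` {1..n} = {1..d n}" using surj[of n] by (simp add: c_def)
  moreover have "c \<in> {1..n} \<rightarrow>\<^sub>E {1..d n}"
    unfolding c_def using surj[of n] by (intro restrict_PiE_iff[THEN iffD2]) blast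
  moreover have "mono_on {1..n} c"
    using mono by (auto intro!: mono_onI simp: ceq)
  ultimately have "c \<in> staircases n (d n)" unfolding staircases_def by blast
  then show ?thesis using ker ceq by (intro exI[of _ "d n"] bexI[of _ c]) auto
qed

section \<open>Inflations and their blocks\<close>

text \<open>The permutations that refine the weak order which \<open>g\<close> puts on the positions.\<close>

definition order_compatible :: "nat \<Rightarrow> (nat \<Rightarrow> nat) \<Rightarrow> (nat \<Rightarrow> nat) set" where
  "order_compatible n g =
     {p. p permutes {1..n} \<and> (\<forall>x\<in>{1..n}. \<forall>y\<in>{1..n}. g x < g y \<longrightarrow> p x < p y)}"

text \<open>The permutations obtained from \<open>s\<close> by replacing its \<open>j\<close>th entry with a block on the \<open>j\<close>th interval of \<open>c\<close>:
that the blocks are arranged like the entries of \<open>s\<close> says that positions in different intervals are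
compared by \<open>p\<close> as their intervals are by \<open>s\<close>. The value intervals need no mention, as order forces them.\<close>

definition inflations :: "nat \<Rightarrow> (nat \<Rightarrow> nat) \<Rightarrow> (nat \<Rightarrow> nat) \<Rightarrow> (nat \<Rightarrow> nat) set" where
  "inflations n s c = order_compatible n (s \<circ> c)"

lemma inflationsD:
  assumes "p \<in> inflations n s c"
  shows "p permutes {1..n}"
    and "\<And>x y. x \<in> {1..n} \<Longrightarrow> y \<in> {1..n} \<Longrightarrow> s (c x) < s (c y) \<Longrightarrow> p x < p y"
    and "\<And>x y. x \<in> {1..n} \<Longrightarrow> y \<in> {1..n} \<Longrightarrow> p x \<le> p y \<Longrightarrow> s (c x) \<le> s (c y)"
proof -
  show "p permutes {1..n}" using assms by (simp add: inflations_def order_compatible_def)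
  show less: "p x < p y" if "x \<in> {1..n}" "y \<in> {1..n}" "s (c x) < s (c y)" for x y
    using assms that by (simp add: inflations_def order_compatible_def)
  show "s (c x) \<le> s (c y)" if "x \<in> {1..n}" "y \<in> {1..n}" "p x \<le> p y" for x y
    using less[of y x] that by (meson leD leI)
qed

lemma permutes_preimage:
  assumes "p permutes {1..n}" "w \<in> {1..n}"
  obtains z where "z \<in> {1..n}" "p z = w"
proof -
  have "w \<in> p ` {1..n}" using assms permutes_image by metis
  then show thesis using that by blast
qed

lemma permutes_interval_mem: "p permutes {1..n} \<Longrightarrow> x \<in> {1..n} \<Longrightarrow> p x \<in> {1..n}"
  using permutes_in_image by metis

text \<open>Both \<open>c\<close> on positions and the map from \<open>p x\<close> to \<open>s (c x)\<close> on values are weakly monotone, and preimages of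
convex sets under monotone maps are convex.\<close>

lemma perm_block_preimage:
  assumes c: "c \<in> staircases n k" and s: "s permutes {1..k}" and p: "p \<in> inflations n s c"
    and T: "perm_block k s T"
  shows "perm_block n p {x \<in> {1..n}. c x \<in> T}" (is "perm_block n p ?B")
proof -
  have pp: "p permutes {1..n}" by (rule inflationsD(1)[OF p])
  have Tne: "T \<noteq> {}" and Tsub: "T \<subseteq> {1..k}" and Tc: "ord_convex T" and sTc: "ord_convex (s ` T)"
    using T unfolding perm_block_iff[OF s] by blast+
  obtain j where j: "j \<in> T" using Tne by blast
  then obtain x where "x \<in> {1..n}" "c x = j" using staircasesD(5)[OF c, of j] Tsub by blast
  then have ne: "?B \<noteq> {}" using j by blast
  have conv: "ord_convex ?B"
    unfolding ord_convex_def
  proof (intro ballI allI impI)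
    fix x y z assume x: "x \<in> ?B" and y: "y \<in> ?B" and le: "x \<le> z" "z \<le> y"
    then have z: "z \<in> {1..n}" by auto
    have "c z \<in> T"
    proof (rule ord_convexD[OF Tc])
      show "c x \<in> T" "c y \<in> T" using x y by auto
      show "c x \<le> c z" "c z \<le> c y" using staircasesD(2)[OF c] x y z le by auto
    qed
    then show "z \<in> ?B" using z by blast
  qed
  have pconv: "ord_convex (p ` ?B)"
    unfolding ord_convex_def
  proof (intro ballI allI impI)
    fix u v w assume "u \<in> p ` ?B" "v \<in> p ` ?B" and le: "u \<le> w" "w \<le> v"
    then obtain x y where x: "x \<in> ?B" "u = p x" and y: "y \<in> ?B" "v = p y" by blast
    have "p x \<in> {1..n}" "p y \<in> {1..n}"
      using x y permutes_interval_mem[OF pp] by auto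
    then have "w \<in> {1..n}" using le x y by auto
    then obtain z where z: "z \<in> {1..n}" "p z = w" by (rule permutes_preimage[OF pp])
    have "s (c z) \<in> s ` T"
    proof (rule ord_convexD[OF sTc])
      show "s (c x) \<in> s ` T" "s (c y) \<in> s ` T" using x y by auto
      show "s (c x) \<le> s (c z)" "s (c z) \<le> s (c y)" using inflationsD(3)[OF p] x y z le by auto
    qed
    then have "c z \<in> T" using inj_image_mem_iff[OF permutes_inj[OF s]] by blast
    then show "w \<in> p ` ?B" using z by blast
  qed
  show ?thesis unfolding perm_block_iff[OF pp] using ne conv pconv by blast
qed

text \<open>Both collapsing maps are also onto, so they send convex sets to convex sets.\<close>

lemma perm_block_quotient:
  assumes c: "c \<in> staircases n k" and s: "s permutes {1..k}" and p: "p \<in> inflations n s c"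
    and B: "perm_block n p B"
  shows "perm_block k s (c ` B)"
proof -
  have pp: "p permutes {1..n}" by (rule inflationsD(1)[OF p])
  have Bne: "B \<noteq> {}" and Bsub: "B \<subseteq> {1..n}" and Bc: "ord_convex B" and pBc: "ord_convex (p ` B)"
    using B unfolding perm_block_iff[OF pp] by blast+
  have sub: "c ` B \<subseteq> {1..k}" using Bsub staircasesD(1)[OF c] by blast
  have conv: "ord_convex (c ` B)"
    unfolding ord_convex_def
  proof (intro ballI allI impI)
    fix u v w assume "u \<in> c ` B" "v \<in> c ` B" and le: "u \<le> w" "w \<le> v"
    then obtain x y where x: "x \<in> B" "u = c x" and y: "y \<in> B" "v = c y" by blast
    have "w \<in> {1..k}" using sub x y le by auto
    then obtain z where z: "z \<in> {1..n}" "c z = w" using staircasesD(5)[OF c] by blast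
    consider "w = u" | "w = v" | "u < w" "w < v" using le by linarith
    then show "w \<in> c ` B"
    proof cases
      case 3
      have "x \<le> z" "z \<le> y" using staircasesD(4)[OF c, of x z] staircasesD(4)[OF c, of z y]
          3 x y z Bsub by auto
      then have "z \<in> B" by (rule ord_convexD[OF Bc x(1) y(1)])
      then show ?thesis using z by blast
    qed (use x y in blast)+
  qed
  have sconv: "ord_convex (s ` c ` B)"
    unfolding ord_convex_def
  proof (intro ballI allI impI)
    fix u v w assume "u \<in> s ` c ` B" "v \<in> s ` c ` B" and le: "u \<le> w" "w \<le> v"
    then obtain x y where x: "x \<in> B" "u = s (c x)" and y: "y \<in> B" "v = s (c y)" by blast
    have "s (c x) \<in> {1..k}" "s (c y) \<in> {1..k}"
      using x y permutes_interval_mem[OF s] sub by blast+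
    then have "w \<in> {1..k}" using x y le by auto
    then obtain j where j: "j \<in> {1..k}" "s j = w" by (rule permutes_preimage[OF s])
    then obtain z where z: "z \<in> {1..n}" "c z = j" using staircasesD(5)[OF c] by blast
    consider "w = u" | "w = v" | "u < w" "w < v" using le by linarith
    then show "w \<in> s ` c ` B"
    proof cases
      case 3
      have "p x < p z" "p z < p y" using inflationsD(2)[OF p, of x z] inflationsD(2)[OF p, of z y]
          3 x y z j Bsub by auto
      then have "p z \<in> p ` B"
        using ord_convexD[OF pBc imageI[OF x(1)] imageI[OF y(1)], of "p z"] by simp
      then have "z \<in> B" using inj_image_mem_iff[OF permutes_inj[OF pp]] by blast
      then show ?thesis using z j by blast
    qed (use x y in blast)+
  qed
  show ?thesis unfolding perm_block_iff[OF s] using Bne sub conv sconv by blast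
qed

lemma simple_permD:
  assumes "simple_perm n p"
  shows "p permutes {1..n}"
    and "perm_block n p B \<Longrightarrow> B \<noteq> {1..n} \<Longrightarrow> x \<in> B \<Longrightarrow> y \<in> B \<Longrightarrow> x = y"
  using assms unfolding simple_perm_def by blast+

lemma ord_convex_remove_end:
  assumes "e = 1 \<or> e = n"
  shows "ord_convex ({1..n} - {e})"
  using assms
proof
  assume "e = 1"
  then have "{1..n} - {e} = {2..n}" by auto
  then show ?thesis by (simp only: ord_convex_atLeastAtMost)
next
  assume "e = n"
  then have "{1..n} - {e} = {1..n - 1}" by auto
  then show ?thesis by (simp only: ord_convex_atLeastAtMost)
qed

text \<open>An entry in a corner of the permutation diagram could be removed: the other entries would occupy
consecutive positions and consecutive values.\<close>

lemma simple_perm_no_corner: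
  assumes s: "simple_perm k s" and k: "3 \<le> k" and e: "e = 1 \<or> e = k"
  shows "s e \<noteq> 1 \<and> s e \<noteq> k"
proof (rule ccontr)
  assume "\<not> ?thesis"
  then have se: "s e = 1 \<or> s e = k" by blast
  note sp = simple_permD(1)[OF s]
  let ?T = "{1..k} - {e}"
  have "s ` ?T = {1..k} - {s e}" using permutes_image_diff[OF sp, of "{e}"] by simp
  then have "ord_convex (s ` ?T)" using ord_convex_remove_end[OF se] by simp
  moreover have "2 \<in> ?T" using e k by auto
  moreover have "e \<in> {1..k}" using e k by auto
  ultimately have bl: "perm_block k s ?T" and ne: "?T \<noteq> {1..k}"
    unfolding perm_block_iff[OF sp] using ord_convex_remove_end[OF e] by blast+
  define f where "f = (if e = 1 then k else 1)"
  have "f \<in> ?T" "f \<noteq> 2" using e k by (auto simp: f_def)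
  then show False using simple_permD(2)[OF s bl ne, of f 2] \<open>2 \<in> ?T\<close> by blast
qed

text \<open>Neither end position may carry an extreme value, but there is only one middle value.\<close>

lemma no_simple_perm_3: "\<not> simple_perm 3 s"
proof
  assume s: "simple_perm 3 s"
  note sp = simple_permD(1)[OF s]
  have "s 1 \<in> {1..3}" "s 3 \<in> {1..3}" using permutes_interval_mem[OF sp] by auto
  moreover have "s 1 \<noteq> 1 \<and> s 1 \<noteq> 3" "s 3 \<noteq> 1 \<and> s 3 \<noteq> 3"
    using simple_perm_no_corner[OF s] by auto
  ultimately have "s 1 = 2" "s 3 = 2" by auto
  then have "s 1 = s 3" by simp
  then have "(1::nat) = 3" using permutes_inj[OF sp] by (metis injD)
  then show False by simp
qed

definition same_block :: "nat \<Rightarrow> (nat \<Rightarrow> nat) \<Rightarrow> nat \<Rightarrow> nat \<Rightarrow> bool" where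
  "same_block n p x y \<longleftrightarrow> (\<exists>B. perm_block n p B \<and> B \<noteq> {1..n} \<and> x \<in> B \<and> y \<in> B)"

text \<open>The direct sums and the skew sums at once: a form that is symmetric in positions and values.\<close>

definition splits :: "nat \<Rightarrow> (nat \<Rightarrow> nat) \<Rightarrow> bool" where
  "splits n p \<longleftrightarrow> (\<exists>B. perm_block n p B \<and> perm_block n p ({1..n} - B))"

text \<open>The image of \<open>B\<close> under \<open>c\<close> is a block of the simple permutation \<open>s\<close>. If it were everything, a position \<open>z\<close> outside
\<open>B\<close> could not lie strictly between positions or values of \<open>B\<close>, so \<open>z\<close> would sit in an end interval both by
position and by value, and \<open>s\<close> would have an entry in a corner. Hence the image is a single point.\<close>

lemma inflation_proper_block:
  assumes c: "c \<in> staircases n k" and s: "simple_perm k s" and k: "3 \<le> k"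
    and p: "p \<in> inflations n s c" and B: "perm_block n p B" "B \<noteq> {1..n}"
    and xy: "x \<in> B" "y \<in> B"
  shows "c x = c y"
proof -
  note sp = simple_permD(1)[OF s]
  note pp = inflationsD(1)[OF p]
  have Bsub: "B \<subseteq> {1..n}" and Bc: "ord_convex B" and pBc: "ord_convex (p ` B)"
    using B(1) unfolding perm_block_iff[OF pp] by blast+
  have bl: "perm_block k s (c ` B)" by (rule perm_block_quotient[OF c sp p B(1)])
  have "c ` B \<noteq> {1..k}"
  proof
    assume full: "c ` B = {1..k}"
    obtain z where z: "z \<in> {1..n}" "z \<notin> B" using B(2) Bsub by blast
    have cz: "c z \<in> {1..k}" by (rule staircasesD(3)[OF c z(1)])
    have e: "c z = 1 \<or> c z = k"
    proof (rule ccontr)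
      assume "\<not> ?thesis"
      then have lt: "1 < c z" "c z < k" using cz by auto
      have "1 \<in> c ` B" "k \<in> c ` B" unfolding full using k by auto
      then obtain u v where u: "u \<in> B" "c u = 1" and v: "v \<in> B" "c v = k" by auto
      have "u < z" "z < v" using staircasesD(4)[OF c] u v z lt Bsub by auto
      then show False using ord_convexD[OF Bc u(1) v(1), of z] z by simp
    qed
    have "s (c z) = 1 \<or> s (c z) = k"
    proof (rule ccontr)
      assume "\<not> ?thesis"
      moreover have "s (c z) \<in> {1..k}" by (rule permutes_interval_mem[OF sp cz])
      ultimately have lt: "1 < s (c z)" "s (c z) < k" by auto
      have "1 \<in> s ` c ` B" "k \<in> s ` c ` B"
        unfolding full permutes_image[OF sp] using k by auto
      then obtain u v where u: "u \<in> B" "s (c u) = 1" and v: "v \<in> B" "s (c v) = k" by auto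
      have "p u < p z" "p z < p v" using inflationsD(2)[OF p] u v z lt Bsub by auto
      then have "p z \<in> p ` B"
        using ord_convexD[OF pBc imageI[OF u(1)] imageI[OF v(1)], of "p z"] by simp
      then show False using z inj_image_mem_iff[OF permutes_inj[OF pp]] by blast
    qed
    then show False using simple_perm_no_corner[OF s k e] by blast
  qed
  then show ?thesis using simple_permD(2)[OF s bl] xy by blast
qed

text \<open>This recovers the partition from the permutation alone: its parts are the maximal proper blocks.\<close>

lemma inflation_same_block_iff:
  assumes c: "c \<in> staircases n k" and s: "simple_perm k s" and k: "3 \<le> k"
    and p: "p \<in> inflations n s c" and xy: "x \<in> {1..n}" "y \<in> {1..n}"
  shows "same_block n p x y \<longleftrightarrow> c x = c y"
proof
  assume "same_block n p x y"
  then show "c x = c y"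
    unfolding same_block_def using inflation_proper_block[OF c s k p] by blast
next
  assume eq: "c x = c y"
  note sp = simple_permD(1)[OF s]
  have "perm_block k s {c x}" by (rule perm_block_singleton[OF sp staircasesD(3)[OF c xy(1)]])
  then have bl: "perm_block n p {z \<in> {1..n}. c z \<in> {c x}}"
    by (rule perm_block_preimage[OF c sp p])
  define j :: nat where "j = (if c x = 1 then 2 else 1)"
  have "j \<in> {1..k}" "j \<noteq> c x" using k by (auto simp: j_def)
  then obtain z where "z \<in> {1..n}" "c z \<noteq> c x" using staircasesD(5)[OF c, of j] by metis
  then have ne: "{z \<in> {1..n}. c z \<in> {c x}} \<noteq> {1..n}" by blast
  show "same_block n p x y"
    unfolding same_block_def
    by (rule exI[of _ "{z \<in> {1..n}. c z \<in> {c x}}"], intro conjI bl ne) (use eq xy in auto)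
qed

text \<open>Each of two complementary blocks would lie in one part, leaving no room for a third.\<close>

lemma inflation_not_splits:
  assumes c: "c \<in> staircases n k" and s: "simple_perm k s" and k: "3 \<le> k"
    and p: "p \<in> inflations n s c"
  shows "\<not> splits n p"
proof
  assume "splits n p"
  then obtain B where B: "perm_block n p B" "perm_block n p ({1..n} - B)"
    unfolding splits_def by blast
  note iff = perm_block_iff[OF inflationsD(1)[OF p]]
  obtain x y where x: "x \<in> B" and y: "y \<in> {1..n} - B" using B unfolding iff by blast
  have sub: "B \<subseteq> {1..n}" using B unfolding iff by blast
  have "B \<noteq> {1..n}" "{1..n} - B \<noteq> {1..n}" using x y sub by blast+
  then have "c z = c x \<or> c z = c y" if "z \<in> {1..n}" for z
    using inflation_proper_block[OF c s k p B(1) _ _ x]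
      inflation_proper_block[OF c s k p B(2) _ _ y] that by blast
  then have "{1..k} \<subseteq> {c x, c y}" unfolding staircasesD(1)[OF c, symmetric] by blast
  then have "card {1..k} \<le> card {c x, c y}" by (intro card_mono) auto
  also have "\<dots> \<le> 2" by (simp add: card_insert_le_m1)
  finally show False using k by simp
qed

lemma permutes_card_le:
  assumes "s permutes {1..k}" "j \<in> {1..k}"
  shows "s j = card {i \<in> {1..k}. s i \<le> s j}"
proof -
  have "s ` {i \<in> {1..k}. s i \<le> s j} = {1..s j}"
  proof (intro equalityI subsetI)
    fix w assume w: "w \<in> {1..s j}"
    then have "w \<in> {1..k}" using permutes_interval_mem[OF assms] by auto
    then obtain i where "i \<in> {1..k}" "s i = w" by (rule permutes_preimage[OF assms(1)])
    then show "w \<in> s ` {i \<in> {1..k}. s i \<le> s j}" using w by auto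
  next
    fix w assume "w \<in> s ` {i \<in> {1..k}. s i \<le> s j}"
    then show "w \<in> {1..s j}" using permutes_interval_mem[OF assms(1)] by force
  qed
  then have "card {1..s j} = card {i \<in> {1..k}. s i \<le> s j}"
    by (metis (no_types, lifting) card_image permutes_inj_on[OF assms(1)])
  then show ?thesis by simp
qed

lemma permutes_eqI_order:
  fixes s t :: "nat \<Rightarrow> nat"
  assumes s: "s permutes {1..k}" and t: "t permutes {1..k}"
    and ord: "\<And>i j. i \<in> {1..k} \<Longrightarrow> j \<in> {1..k} \<Longrightarrow> s i < s j \<Longrightarrow> t i < t j"
  shows "s = t"
proof
  fix j
  show "s j = t j"
  proof (cases "j \<in> {1..k}")
    case True
    have "s i \<le> s j \<longleftrightarrow> t i \<le> t j" if i: "i \<in> {1..k}" for i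
    proof (cases "i = j")
      case False
      then have "s i \<noteq> s j" using permutes_inj[OF s] by (auto dest: injD)
      then consider "s i < s j" | "s j < s i" by linarith
      then show ?thesis using ord[OF i True] ord[OF True i] by cases auto
    qed simp
    then have "{i \<in> {1..k}. s i \<le> s j} = {i \<in> {1..k}. t i \<le> t j}" by blast
    then show ?thesis using permutes_card_le[OF s True] permutes_card_le[OF t True] by simp
  next
    case False
    then show ?thesis using permutes_not_in[OF s] permutes_not_in[OF t] by metis
  qed
qed

lemma standardization:
  fixes h :: "nat \<Rightarrow> nat"
  assumes "inj_on h {1..k}"
  obtains s where "s permutes {1..k}"
    and "\<And>i j. i \<in> {1..k} \<Longrightarrow> j \<in> {1..k} \<Longrightarrow> s i < s j \<longleftrightarrow> h i < h j"
proof -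
  define s where "s j = (if j \<in> {1..k} then card {i \<in> {1..k}. h i \<le> h j} else j)" for j
  have less: "s i < s j" if "i \<in> {1..k}" "j \<in> {1..k}" "h i < h j" for i j
  proof -
    have "{l \<in> {1..k}. h l \<le> h i} \<subset> {l \<in> {1..k}. h l \<le> h j}"
      using that by (auto simp: psubset_eq set_eq_iff intro!: exI[of _ j])
    then have "card {l \<in> {1..k}. h l \<le> h i} < card {l \<in> {1..k}. h l \<le> h j}"
      by (intro psubset_card_mono) auto
    then show ?thesis using that by (simp add: s_def)
  qed
  have iff: "s i < s j \<longleftrightarrow> h i < h j" if "i \<in> {1..k}" "j \<in> {1..k}" for i j
  proof
    assume lt: "s i < s j"
    then have "\<not> h j < h i" using less[of j i] that by auto
    moreover have "h i \<noteq> h j" using lt inj_onD[OF assms _ that] by blast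
    ultimately show "h i < h j" by simp
  qed (rule less[OF that])
  have "inj_on s {1..k}"
  proof (rule inj_onI)
    fix i j assume ij: "i \<in> {1..k}" "j \<in> {1..k}" "s i = s j"
    then have "\<not> h i < h j" "\<not> h j < h i" using iff[of i j] iff[of j i] by auto
    then show "i = j" using inj_onD[OF assms _ ij(1,2)] by simp
  qed
  moreover have "s ` {1..k} \<subseteq> {1..k}"
  proof
    fix w assume "w \<in> s ` {1..k}"
    then obtain j where j: "j \<in> {1..k}" "w = s j" by blast
    have "card {i \<in> {1..k}. h i \<le> h j} \<le> card {1..k}" by (rule card_mono) auto
    moreover have "card {i \<in> {1..k}. h i \<le> h j} > 0" using j by (auto simp: card_gt_0_iff)
    ultimately show "w \<in> {1..k}" using j by (simp add: s_def)
  qed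
  ultimately have "bij_betw s {1..k} {1..k}"
    by (simp add: bij_betw_def endo_inj_surj)
  then have "s permutes {1..k}"
    by (rule bij_imp_permutes) (auto simp: s_def)
  then show thesis using that iff by blast
qed

section \<open>Unique decomposition of permutations that do not split\<close>

lemma inflation_unique:
  assumes c: "c \<in> staircases n k" and s: "simple_perm k s" and k: "3 \<le> k"
    and p: "p \<in> inflations n s c"
    and d: "d \<in> staircases n l" and t: "simple_perm l t" and l: "3 \<le> l"
    and q: "p \<in> inflations n t d"
  shows "k = l \<and> s = t \<and> c = d"
proof -
  have "c = d \<and> k = l"
    using c d
  proof (rule staircase_eqI)
    fix x y assume "x \<in> {1..n}" "y \<in> {1..n}"
    then show "c x = c y \<longleftrightarrow> d x = d y"
      using inflation_same_block_iff[OF c s k p] inflation_same_block_iff[OF d t l q] by metis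
  qed
  then have eq: "d = c" "l = k" by auto
  have "s = t"
  proof (rule permutes_eqI_order)
    show "s permutes {1..k}" by (rule simple_permD(1)[OF s])
    show tp: "t permutes {1..k}" using simple_permD(1)[OF t] eq by simp
    fix i j assume ij: "i \<in> {1..k}" "j \<in> {1..k}" and lt: "s i < s j"
    obtain x where x: "x \<in> {1..n}" "c x = i" using staircasesD(5)[OF c ij(1)] by blast
    obtain y where y: "y \<in> {1..n}" "c y = j" using staircasesD(5)[OF c ij(2)] by blast
    have "p x < p y" using inflationsD(2)[OF p x(1) y(1)] lt x y by simp
    then have "t (d x) \<le> t (d y)" using inflationsD(3)[OF q x(1) y(1)] by simp
    then have "t i \<le> t j" using x y eq by simp
    moreover have "t i \<noteq> t j" using injD[OF permutes_inj[OF tp], of i j] lt by auto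
    ultimately show "t i < t j" by simp
  qed
  then show ?thesis using eq by simp
qed

lemma perm_block_Un:
  assumes p: "p permutes {1..n}" and A: "perm_block n p A" and B: "perm_block n p B"
    and x: "x \<in> A" "x \<in> B"
  shows "perm_block n p (A \<union> B)"
proof -
  note iff = perm_block_iff[OF p]
  have cA: "ord_convex A" and pA: "ord_convex (p ` A)" and sA: "A \<subseteq> {1..n}"
    using A unfolding iff by blast+
  have cB: "ord_convex B" and pB: "ord_convex (p ` B)" and sB: "B \<subseteq> {1..n}"
    using B unfolding iff by blast+
  have "ord_convex (A \<union> B)" by (rule ord_convex_Un[OF cA cB x])
  moreover have "ord_convex (p ` (A \<union> B))"
    unfolding image_Un by (rule ord_convex_Un[OF pA pB imageI[OF x(1)] imageI[OF x(2)]])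
  ultimately show ?thesis unfolding iff using sA sB x by blast
qed

lemma perm_block_complement:
  assumes p: "p permutes {1..n}" and A: "perm_block n p A" "A \<noteq> {1..n}"
    and B: "perm_block n p B" "B \<noteq> {1..n}" and full: "A \<union> B = {1..n}"
  shows "perm_block n p ({1..n} - B)"
proof -
  note iff = perm_block_iff[OF p]
  have cA: "ord_convex A" and pA: "ord_convex (p ` A)" and sA: "A \<subseteq> {1..n}"
    using A unfolding iff by blast+
  have cB: "ord_convex B" and pB: "ord_convex (p ` B)" and sB: "B \<subseteq> {1..n}"
    using B unfolding iff by blast+
  have "ord_convex ({1..n} - B)" by (rule ord_convex_complement[OF cA cB full A(2)])
  moreover have "ord_convex ({1..n} - p ` B)"
  proof (rule ord_convex_complement[OF pA pB])
    show "p ` A \<union> p ` B = {1..n}" using full permutes_image[OF p] by (metis image_Un)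
    show "p ` A \<noteq> {1..n}"
    proof
      assume "p ` A = {1..n}"
      then have "p ` A = p ` {1..n}" using permutes_image[OF p] by simp
      then show False using A(2) inj_image_eq_iff[OF permutes_inj[OF p]] by blast
    qed
  qed
  then have "ord_convex (p ` ({1..n} - B))" by (simp only: permutes_image_diff[OF p])
  ultimately show ?thesis unfolding iff using sB B(2) by blast
qed

text \<open>Two overlapping proper blocks have a block as their union. If it were everything, one of them and its
complement would split the permutation.\<close>

lemma same_block_trans:
  assumes p: "p permutes {1..n}" and ns: "\<not> splits n p"
    and xy: "same_block n p x y" and yz: "same_block n p y z"
  shows "same_block n p x z"
proof -
  obtain A where A: "perm_block n p A" "A \<noteq> {1..n}" "x \<in> A" "y \<in> A"
    using xy unfolding same_block_def by blast
  obtain B where B: "perm_block n p B" "B \<noteq> {1..n}" "y \<in> B" "z \<in> B"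
    using yz unfolding same_block_def by blast
  have "A \<union> B \<noteq> {1..n}"
  proof
    assume "A \<union> B = {1..n}"
    then have "perm_block n p ({1..n} - B)"
      by (rule perm_block_complement[OF p A(1,2) B(1,2)])
    then show False using ns B(1) unfolding splits_def by blast
  qed
  moreover have "perm_block n p (A \<union> B)" by (rule perm_block_Un[OF p A(1) B(1) A(4) B(3)])
  moreover have "x \<in> A \<union> B" "z \<in> A \<union> B" using A B by blast+
  ultimately show ?thesis unfolding same_block_def by blast
qed

lemma same_block_between:
  assumes p: "p permutes {1..n}" and xy: "same_block n p x y"
  shows "x \<le> z \<Longrightarrow> z \<le> y \<Longrightarrow> same_block n p x z"
    and "p x \<le> p z \<Longrightarrow> p z \<le> p y \<Longrightarrow> same_block n p x z"
proof -
  obtain A where A: "perm_block n p A" "A \<noteq> {1..n}" "x \<in> A" "y \<in> A"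
    using xy unfolding same_block_def by blast
  have cA: "ord_convex A" and pA: "ord_convex (p ` A)"
    using A(1) unfolding perm_block_iff[OF p] by blast+
  show "same_block n p x z" if "x \<le> z" "z \<le> y"
  proof -
    have "z \<in> A" by (rule ord_convexD[OF cA A(3,4) that])
    then show ?thesis unfolding same_block_def using A by blast
  qed
  show "same_block n p x z" if "p x \<le> p z" "p z \<le> p y"
  proof -
    have "p z \<in> p ` A" by (rule ord_convexD[OF pA imageI[OF A(3)] imageI[OF A(4)] that])
    then have "z \<in> A" using inj_image_mem_iff[OF permutes_inj[OF p]] by blast
    then show ?thesis unfolding same_block_def using A by blast
  qed
qed

lemma same_block_refl:
  assumes p: "p permutes {1..n}" and n: "2 \<le> n" and x: "x \<in> {1..n}"
  shows "same_block n p x x"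
proof -
  have "perm_block n p {x}" by (rule perm_block_singleton[OF p x])
  moreover have "card {x} \<noteq> card {1..n}" using n by simp
  then have "{x} \<noteq> {1..n}" by metis
  ultimately show ?thesis unfolding same_block_def by blast
qed

lemma same_block_sym: "same_block n p x y \<Longrightarrow> same_block n p y x"
  unfolding same_block_def by blast

lemma same_block_mem:
  assumes "p permutes {1..n}" "same_block n p x y"
  shows "x \<in> {1..n}"
  using assms(2) unfolding same_block_def perm_block_iff[OF assms(1)] by blast

text \<open>The parts are the classes of lying in a common proper block, and the quotient is the standardization of
the values at chosen representatives. A block of the quotient pulls back to a block of \<open>p\<close>, hence to a
single class or to everything, so the quotient is simple. Length 1 would put both ends into a common
proper block, length 2 would make \<open>p\<close> split, and length 3 admits no simple permutation.\<close>

lemma inflation_exists: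
  assumes p: "p permutes {1..n}" and n: "2 \<le> n" and ns: "\<not> splits n p"
  obtains k s c where "4 \<le> k" "simple_perm k s" "c \<in> staircases n k" "p \<in> inflations n s c"
proof -
  let ?R = "same_block n p"
  have "\<exists>k. \<exists>c\<in>staircases n k. \<forall>x\<in>{1..n}. \<forall>y\<in>{1..n}. c x = c y \<longleftrightarrow> ?R x y"
  proof (rule staircase_exists)
    show "?R x x" if "x \<in> {1..n}" for x by (rule same_block_refl[OF p n that])
    show "?R y x" if "?R x y" for x y by (rule same_block_sym[OF that])
    show "?R x z" if "?R x y" "?R y z" for x y z by (rule same_block_trans[OF p ns that])
    show "x \<in> {1..n}" if "?R x y" for x y by (rule same_block_mem[OF p that])
    show "?R x z" if "?R x y" "x \<le> z" "z \<le> y" for x y z by (rule same_block_between(1)[OF p that])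
  qed
  then obtain k c where c: "c \<in> staircases n k"
    and ker: "\<And>x y. x \<in> {1..n} \<Longrightarrow> y \<in> {1..n} \<Longrightarrow> c x = c y \<longleftrightarrow> ?R x y" by blast
  define r where "r j = (SOME x. x \<in> {1..n} \<and> c x = j)" for j
  have r: "r j \<in> {1..n}" "c (r j) = j" if "j \<in> {1..k}" for j
    using someI_ex[of "\<lambda>x. x \<in> {1..n} \<and> c x = j"] staircasesD(5)[OF c that]
    unfolding r_def by blast+
  have "inj_on (\<lambda>j. p (r j)) {1..k}"
  proof (rule inj_onI)
    fix i j assume ij: "i \<in> {1..k}" "j \<in> {1..k}" "p (r i) = p (r j)"
    then have "r i = r j" using injD[OF permutes_inj[OF p]] by blast
    then show "i = j" using r ij by metis
  qed
  then obtain s where s: "s permutes {1..k}"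
    and sord: "\<And>i j. i \<in> {1..k} \<Longrightarrow> j \<in> {1..k} \<Longrightarrow> s i < s j \<longleftrightarrow> p (r i) < p (r j)"
    by (rule standardization) blast
  have infl: "p x < p y" if x: "x \<in> {1..n}" and y: "y \<in> {1..n}" and lt: "s (c x) < s (c y)" for x y
  proof (rule ccontr)
    assume "\<not> p x < p y"
    then have le: "p y \<le> p x" by simp
    have cx: "c x \<in> {1..k}" and cy: "c y \<in> {1..k}" using staircasesD(3)[OF c] x y by blast+
    let ?a = "r (c x)" and ?b = "r (c y)"
    have a: "?a \<in> {1..n}" and b: "?b \<in> {1..n}" using r cx cy by blast+
    have ax: "?R ?a x" and bx: "?R ?b y"
      using ker[OF a x] ker[OF b y] r(2)[OF cx] r(2)[OF cy] by blast+
    have ab: "p ?a < p ?b" using sord[OF cx cy] lt by blast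
    \<comment> \<open>If the values of the two classes interleave, one representative has its value between two
      values of the other class, and convexity of that class merges the two.\<close>
    have "?R x y"
    proof (cases "p ?b \<le> p x")
      case True
      have "?R ?a ?b" by (rule same_block_between(2)[OF p ax]) (use ab True in auto)
      then have "c ?a = c ?b" using ker[OF a b] by blast
      then have "c x = c y" using r(2)[OF cx] r(2)[OF cy] by simp
      then show ?thesis using lt by simp
    next
      case False
      have "?R y x" by (rule same_block_between(2)[OF p same_block_sym[OF bx]]) (use le False in auto)
      then show ?thesis by (rule same_block_sym)
    qed
    then have "c x = c y" using ker[OF x y] by blast
    then show False using lt by simp
  qed
  have p_infl: "p \<in> inflations n s c" unfolding inflations_def order_compatible_def using p infl by simp
  have simple: "simple_perm k s"
    unfolding simple_perm_def
  proof (intro conjI s allI impI)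
    fix T assume T: "perm_block k s T"
    let ?B = "{x \<in> {1..n}. c x \<in> T}"
    have Tne: "T \<noteq> {}" and Tsub: "T \<subseteq> {1..k}" using T unfolding perm_block_iff[OF s] by blast+
    have B: "perm_block n p ?B" by (rule perm_block_preimage[OF c s p_infl T])
    show "(\<exists>i. T = {i}) \<or> T = {1..k}"
    proof (cases "?B = {1..n}")
      case True
      have "j \<in> T" if "j \<in> {1..k}" for j
      proof -
        have "r j \<in> ?B" using r(1)[OF that] True by blast
        then show ?thesis using r(2)[OF that] by simp
      qed
      then show ?thesis using Tsub by blast
    next
      case False
      have "i = j" if "i \<in> T" "j \<in> T" for i j
      proof -
        have ij: "i \<in> {1..k}" "j \<in> {1..k}" using that Tsub by blast+
        have "r i \<in> ?B" "r j \<in> ?B" using r[OF ij(1)] r[OF ij(2)] that by auto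
        then have "?R (r i) (r j)" unfolding same_block_def using B False by blast
        then have "c (r i) = c (r j)" using ker r(1) ij by blast
        then show "i = j" using r(2) ij by simp
      qed
      then show ?thesis using Tne by blast
    qed
  qed
  have k2: "\<not> k \<le> 1"
  proof
    assume "k \<le> 1"
    have "1 \<in> {1..n}" "n \<in> {1..n}" using n by auto
    moreover from this have "c 1 = c n"
      using staircasesD(3)[OF c, of 1] staircasesD(3)[OF c, of n] \<open>k \<le> 1\<close> by simp
    ultimately have "?R 1 n" using ker by blast
    then obtain B where B: "perm_block n p B" "B \<noteq> {1..n}" "1 \<in> B" "n \<in> B"
      unfolding same_block_def by blast
    have "ord_convex B" and sub: "B \<subseteq> {1..n}" using B(1) unfolding perm_block_iff[OF p] by blast+
    then have "z \<in> B" if "z \<in> {1..n}" for z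
      using ord_convexD[OF \<open>ord_convex B\<close> B(3,4), of z] that by simp
    then show False using B(2) sub by blast
  qed
  have "k \<noteq> 2"
  proof
    assume k: "k = 2"
    let ?B = "\<lambda>j. {x \<in> {1..n}. c x \<in> {j}}"
    have bl: "perm_block n p (?B j)" if "j \<in> {1..k}" for j
      by (rule perm_block_preimage[OF c s p_infl perm_block_singleton[OF s that]])
    have "{1..n} - ?B 1 = ?B 2"
      using staircasesD(3)[OF c] unfolding k by force
    then have "perm_block n p ({1..n} - ?B 1)" using bl[of 2] k by simp
    moreover have "perm_block n p (?B 1)" using bl[of 1] k by simp
    ultimately show False using ns unfolding splits_def by blast
  qed
  moreover have "k \<noteq> 3" using simple no_simple_perm_3 by blast
  ultimately have "4 \<le> k" using k2 by linarith
  then show thesis using that simple c p_infl by blast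
qed

section \<open>Counting inflations\<close>

text \<open>Such a permutation is the same as an independent choice of a permutation on every fibre of \<open>g\<close>.\<close>

lemma card_fibre_preserving_permutations:
  assumes A: "finite A"
  shows "card {q. q permutes A \<and> (\<forall>x\<in>A. g (q x) = g x)} = (\<Prod>i\<in>g ` A. fact (card {x \<in> A. g x = i}))"
proof -
  let ?I = "\<lambda>i. {x \<in> A. g x = i}"
  let ?P = "\<Pi>\<^sub>E i\<in>g ` A. {q. q permutes ?I i}"
  let ?H = "{q. q permutes A \<and> (\<forall>x\<in>A. g (q x) = g x)}"
  let ?F = "\<lambda>G x. if x \<in> A then G (g x) x else x"
  let ?G = "\<lambda>q. \<lambda>i\<in>g ` A. \<lambda>x. if x \<in> ?I i then q x else x"
  have "bij_betw ?F ?P ?H"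
  proof (rule bij_betw_byWitness[where f' = ?G])
    show "\<forall>G\<in>?P. ?G (?F G) = G"
    proof
      fix G assume G: "G \<in> ?P"
      show "?G (?F G) = G"
      proof (rule PiE_ext[OF _ G])
        have "?G (?F G) i = G i" if i: "i \<in> g ` A" for i
        proof -
          have Gi: "G i permutes ?I i" using PiE_mem[OF G i] by simp
          show ?thesis
          proof
            fix x show "?G (?F G) i x = G i x"
              using i permutes_not_in[OF Gi, of x] by (cases "x \<in> ?I i") auto
          qed
        qed
        then show eq: "?G (?F G) i = G i" if "i \<in> g ` A" for i using that by blast
        show "?G (?F G) \<in> ?P"
        proof (rule PiE_I)
          fix i assume i: "i \<in> g ` A"
          then show "?G (?F G) i \<in> {q. q permutes ?I i}"
            unfolding eq[OF i] using PiE_mem[OF G i] by simp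
        qed simp
      qed
    qed
    show "\<forall>q\<in>?H. ?F (?G q) = q"
    proof
      fix q assume q: "q \<in> ?H"
      then have qp: "q permutes A" by blast
      show "?F (?G q) = q"
      proof
        fix x show "?F (?G q) x = q x"
          using permutes_not_in[OF qp, of x] by (cases "x \<in> A") auto
      qed
    qed
    show "?F ` ?P \<subseteq> ?H"
    proof
      fix f assume "f \<in> ?F ` ?P"
      then obtain G where G: "G \<in> ?P" and f: "f = ?F G" by blast
      have Gp: "G (g x) permutes ?I (g x)" if "x \<in> A" for x using PiE_mem[OF G, of "g x"] that by simp
      have mem: "f x \<in> A \<and> g (f x) = g x" if x: "x \<in> A" for x
      proof -
        have "G (g x) x \<in> ?I (g x)" using permutes_in_image[OF Gp[OF x], of x] x by simp
        then show ?thesis using f x by simp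
      qed
      have "inj_on f A"
      proof (rule inj_onI)
        fix x y assume xy: "x \<in> A" "y \<in> A" "f x = f y"
        then have "g x = g y" using mem[of x] mem[of y] by metis
        then have "G (g x) x = G (g x) y" using xy f by simp
        then show "x = y" using injD[OF permutes_inj[OF Gp[OF xy(1)]]] by blast
      qed
      then have "f permutes A"
        by (intro inj_imp_permutes) (use mem f A in auto)
      then show "f \<in> ?H" using mem by blast
    qed
    show "?G ` ?H \<subseteq> ?P"
    proof
      fix G assume "G \<in> ?G ` ?H"
      then obtain q where qp: "q permutes A" and qg: "\<And>x. x \<in> A \<Longrightarrow> g (q x) = g x" and G: "G = ?G q"
        by blast
      show "G \<in> ?P"
        unfolding G
      proof (rule PiE_I)
        fix i assume i: "i \<in> g ` A"
        have "(\<lambda>x. if x \<in> ?I i then q x else x) permutes ?I i"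
        proof (rule inj_imp_permutes)
          show "inj_on (\<lambda>x. if x \<in> ?I i then q x else x) (?I i)"
            using injD[OF permutes_inj[OF qp]] by (auto intro!: inj_onI)
          show "(if x \<in> ?I i then q x else x) \<in> ?I i" if "x \<in> ?I i" for x
            using that qg permutes_in_image[OF qp, of x] by auto
        qed (use A in auto)
        then show "?G q i \<in> {q. q permutes ?I i}" using i by simp
      qed simp
    qed
  qed
  then have "card ?H = card ?P" by (rule bij_betw_same_card[symmetric])
  also have "\<dots> = (\<Prod>i\<in>g ` A. card {q. q permutes ?I i})" by (rule card_PiE) (simp add: A)
  also have "\<dots> = (\<Prod>i\<in>g ` A. fact (card (?I i)))"
    by (rule prod.cong) (auto intro: card_permutations simp: A)
  finally show ?thesis .
qed

text \<open>The value assigned to a position is its rank. If \<open>g y < g x\<close>, the positions ranked by \<open>q\<close> up to \<open>y\<close> have level at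
most \<open>g y\<close>, and \<open>p\<close> ranks all of those strictly before \<open>x\<close>; so the two ranks differ.\<close>

lemma order_compatible_same_value:
  assumes p: "p \<in> order_compatible n g" and q: "q \<in> order_compatible n g"
    and xy: "x \<in> {1..n}" "y \<in> {1..n}" "q y = p x"
  shows "g x \<le> g y"
proof (rule ccontr)
  assume "\<not> g x \<le> g y"
  then have lt: "g y < g x" by simp
  have pp: "p permutes {1..n}" and qp: "q permutes {1..n}" using p q by (simp_all add: order_compatible_def)
  have "{z \<in> {1..n}. q z \<le> q y} \<subseteq> {z \<in> {1..n}. g z \<le> g y}"
  proof
    fix z assume z: "z \<in> {z \<in> {1..n}. q z \<le> q y}"
    then have "\<not> g y < g z" using q xy(2) unfolding order_compatible_def by fastforce
    then show "z \<in> {z \<in> {1..n}. g z \<le> g y}" using z by simp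
  qed
  also have "\<dots> \<subset> {z \<in> {1..n}. p z \<le> p x}"
  proof
    show "{z \<in> {1..n}. g z \<le> g y} \<subseteq> {z \<in> {1..n}. p z \<le> p x}"
    proof
      fix z assume z: "z \<in> {z \<in> {1..n}. g z \<le> g y}"
      then have "p z < p x" using p xy(1) lt unfolding order_compatible_def by fastforce
      then show "z \<in> {z \<in> {1..n}. p z \<le> p x}" using z by simp
    qed
    have "x \<in> {z \<in> {1..n}. p z \<le> p x}" "x \<notin> {z \<in> {1..n}. g z \<le> g y}" using xy(1) lt by auto
    then show "{z \<in> {1..n}. g z \<le> g y} \<noteq> {z \<in> {1..n}. p z \<le> p x}" by metis
  qed
  finally have "card {z \<in> {1..n}. q z \<le> q y} < card {z \<in> {1..n}. p z \<le> p x}"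
    by (intro psubset_card_mono) simp_all
  then show False
    using permutes_card_le[OF qp xy(2)] permutes_card_le[OF pp xy(1)] xy(3) by simp
qed

text \<open>Breaking ties of \<open>g\<close> by position gives one compatible permutation \<open>r\<close>. The compatible ones are exactly the
products of \<open>r\<close> with a permutation of positions that preserves the fibres of \<open>g\<close>.\<close>

lemma card_order_compatible:
  "card (order_compatible n g) = (\<Prod>i\<in>g ` {1..n}. fact (card {x \<in> {1..n}. g x = i}))"
proof -
  let ?H = "{q. q permutes {1..n} \<and> (\<forall>x\<in>{1..n}. g (q x) = g x)}"
  (* lexicographic order on level and position *)
  define h where "h x = g x * Suc n + x" for x
  have h: "g x < g y \<Longrightarrow> h x < h y" if "x \<in> {1..n}" for x y
  proof -
    assume "g x < g y"
    then have "Suc (g x) * Suc n \<le> g y * Suc n" by (intro mult_le_mono1) simp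
    then show "h x < h y" using that by (simp add: h_def)
  qed
  have "inj_on h {1..n}"
  proof (rule inj_onI)
    fix x y assume xy: "x \<in> {1..n}" "y \<in> {1..n}" "h x = h y"
    then have "g x = g y" using h[of x y] h[of y x] by (metis less_irrefl linorder_neqE_nat)
    then show "x = y" using xy by (simp add: h_def)
  qed
  then obtain r where rp: "r permutes {1..n}"
    and r: "\<And>x y. x \<in> {1..n} \<Longrightarrow> y \<in> {1..n} \<Longrightarrow> r x < r y \<longleftrightarrow> h x < h y"
    by (rule standardization) blast
  have rc: "r \<in> order_compatible n g"
    unfolding order_compatible_def using rp r h by blast
  have "bij_betw (\<lambda>q. r \<circ> q) ?H (order_compatible n g)"
  proof (rule bij_betw_imageI)
    show "inj_on (\<lambda>q. r \<circ> q) ?H"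
    proof (rule inj_onI)
      fix q q' assume "r \<circ> q = r \<circ> q'"
      then have "inv r \<circ> r \<circ> q = inv r \<circ> r \<circ> q'" by (simp add: comp_assoc)
      then show "q = q'" by (simp add: permutes_inv_o[OF rp])
    qed
    show "(\<lambda>q. r \<circ> q) ` ?H = order_compatible n g"
    proof (intro equalityI subsetI)
      fix p assume "p \<in> (\<lambda>q. r \<circ> q) ` ?H"
      then obtain q where qp: "q permutes {1..n}" and qg: "\<And>x. x \<in> {1..n} \<Longrightarrow> g (q x) = g x"
        and p: "p = r \<circ> q" by blast
      have "p x < p y" if "x \<in> {1..n}" "y \<in> {1..n}" "g x < g y" for x y
        using rc that qg permutes_interval_mem[OF qp] unfolding order_compatible_def p by simp
      then show "p \<in> order_compatible n g"
        unfolding order_compatible_def using permutes_compose[OF qp rp] p by blast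
    next
      fix p assume p: "p \<in> order_compatible n g"
      then have pp: "p permutes {1..n}" by (simp add: order_compatible_def)
      define q where "q = inv r \<circ> p"
      have qp: "q permutes {1..n}"
        unfolding q_def by (rule permutes_compose[OF pp permutes_inv[OF rp]])
      have rq: "r (q x) = p x" for x
        unfolding q_def using permutes_inverses(1)[OF rp] by simp
      have "g (q x) = g x" if x: "x \<in> {1..n}" for x
      proof (rule antisym)
        have qx: "q x \<in> {1..n}" by (rule permutes_interval_mem[OF qp x])
        show "g (q x) \<le> g x" by (rule order_compatible_same_value[OF rc p qx x rq[symmetric]])
        show "g x \<le> g (q x)" by (rule order_compatible_same_value[OF p rc x qx rq])
      qed
      moreover have "p = r \<circ> q" using rq by auto
      ultimately show "p \<in> (\<lambda>q. r \<circ> q) ` ?H" using qp by blast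
    qed
  qed
  then have "card (order_compatible n g) = card ?H" by (rule bij_betw_same_card[symmetric])
  then show ?thesis by (simp only: card_fibre_preserving_permutations[OF finite_atLeastAtMost])
qed

lemma card_inflations:
  assumes c: "c \<in> staircases n k" and s: "s permutes {1..k}"
  shows "card (inflations n s c) = (\<Prod>j\<in>{1..k}. fact (card (fibre n c j)))"
proof -
  have inj: "inj_on s {1..k}" by (rule permutes_inj_on[OF s])
  have "(s \<circ> c) ` {1..n} = s ` {1..k}" by (simp only: image_comp[symmetric] staircasesD(1)[OF c])
  then have "card (inflations n s c) = (\<Prod>i\<in>s ` {1..k}. fact (card {x \<in> {1..n}. (s \<circ> c) x = i}))"
    by (simp only: inflations_def card_order_compatible)
  also have "\<dots> = (\<Prod>j\<in>{1..k}. fact (card {x \<in> {1..n}. (s \<circ> c) x = s j}))"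
    by (simp only: prod.reindex[OF inj] o_def)
  also have "\<dots> = (\<Prod>j\<in>{1..k}. fact (card (fibre n c j)))"
    using permutes_inj[OF s] by (simp add: fibre_def inj_eq)
  finally show ?thesis .
qed

section \<open>Powers of the factorial series\<close>

lemma fact_series_nth: "fps_nth fact_series n = (if n = 0 then 0 else fact n)"
  by (simp add: fact_series_def)

definition extend_staircase :: "nat \<Rightarrow> nat \<Rightarrow> nat \<Rightarrow> (nat \<Rightarrow> nat) \<Rightarrow> nat \<Rightarrow> nat" where
  "extend_staircase n k m c = (\<lambda>x\<in>{1..n}. if x \<le> m then c x else Suc k)"

lemma extend_staircase_mem:
  assumes c: "c \<in> staircases m k" and m: "m < n"
  shows "extend_staircase n k m c \<in> staircases n (Suc k)" (is "?d \<in> _")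
proof -
  have d: "?d x = (if x \<le> m then c x else Suc k)" if "x \<in> {1..n}" for x
    using that by (simp add: extend_staircase_def)
  have ck: "c x \<in> {1..k}" if "1 \<le> x" "x \<le> m" for x
    using staircasesD(3)[OF c, of x] that by simp
  have im: "?d ` {1..n} = {1..Suc k}"
  proof (intro equalityI subsetI)
    fix j assume "j \<in> ?d ` {1..n}"
    then obtain x where x: "x \<in> {1..n}" "j = ?d x" by blast
    then show "j \<in> {1..Suc k}" using ck[of x] d[OF x(1)] by (cases "x \<le> m") auto
  next
    fix j assume j: "j \<in> {1..Suc k}"
    show "j \<in> ?d ` {1..n}"
    proof (cases "j = Suc k")
      case True
      then have "j = ?d n" using d[of n] m by simp
      then show ?thesis using m by auto
    next
      case False
      then obtain x where x: "x \<in> {1..m}" "c x = j" using staircasesD(5)[OF c, of j] j by auto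
      then have "j = ?d x" "x \<in> {1..n}" using d[of x] m by auto
      then show ?thesis by blast
    qed
  qed
  have "mono_on {1..n} ?d"
  proof (rule mono_onI)
    fix x y assume xy: "x \<in> {1..n}" "y \<in> {1..n}" "x \<le> y"
    show "?d x \<le> ?d y"
    proof (cases "y \<le> m")
      case True
      then show ?thesis using xy d staircasesD(2)[OF c, of x y] by simp
    next
      case False
      then show ?thesis using xy d ck[of x] by (cases "x \<le> m") simp_all
    qed
  qed
  moreover have "?d \<in> {1..n} \<rightarrow>\<^sub>E {1..Suc k}"
  proof (rule PiE_I)
    show "?d x \<in> {1..Suc k}" if "x \<in> {1..n}" for x using im that by blast
  qed (auto simp: extend_staircase_def)
  ultimately show ?thesis unfolding staircases_def using im by blast
qed

lemma fibre_extend_staircase: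
  assumes c: "c \<in> staircases m k" and m: "m < n"
  shows "j \<in> {1..k} \<Longrightarrow> fibre n (extend_staircase n k m c) j = fibre m c j"
    and "fibre n (extend_staircase n k m c) (Suc k) = {Suc m..n}"
proof -
  have ck: "c x \<noteq> Suc k" if "1 \<le> x" "x \<le> m" for x
    using staircasesD(3)[OF c, of x] that by simp
  then show "fibre n (extend_staircase n k m c) (Suc k) = {Suc m..n}"
    using m by (auto simp: fibre_def extend_staircase_def)
  show "fibre n (extend_staircase n k m c) j = fibre m c j" if "j \<in> {1..k}"
    using m that by (auto simp: fibre_def extend_staircase_def)
qed

lemma restrict_staircase:
  assumes d: "d \<in> staircases n (Suc k)"
  obtains m c where "m < n" "c \<in> staircases m k" "d = extend_staircase n k m c"
proof -
  let ?D = "{x \<in> {1..n}. d x \<le> k}"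
  define m where "m = card ?D"
  have D: "?D = {1..m}"
  proof (cases "?D = {}")
    case False
    then obtain x where x: "x \<in> {1..n}" "d x \<le> k" by blast
    have "d 1 \<le> d x" using staircasesD(2)[OF d, of 1 x] x by auto
    then have 1: "1 \<in> ?D" using x by auto
    have "ord_convex ?D"
      unfolding ord_convex_def
    proof (intro ballI allI impI)
      fix x y z assume xy: "x \<in> ?D" "y \<in> ?D" "x \<le> z" "z \<le> y"
      then have z: "z \<in> {1..n}" by auto
      have "d z \<le> d y" using staircasesD(2)[OF d z, of y] xy by blast
      then show "z \<in> ?D" using z xy by auto
    qed
    then show ?thesis unfolding m_def by (rule ord_convex_initial) (use 1 in auto)
  next
    case True
    then have "m = 0" by (simp only: m_def card.empty)
    then show ?thesis using True by simp
  qed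
  have D': "d x \<le> k \<longleftrightarrow> x \<le> m" if "x \<in> {1..n}" for x
    using that D by (simp add: set_eq_iff) (metis that atLeastAtMost_iff)
  obtain z where z: "z \<in> {1..n}" "d z = Suc k" using staircasesD(5)[OF d, of "Suc k"] by auto
  then have mn: "m < n" using D'[OF z(1)] by auto
  define c where "c = restrict d {1..m}"
  have cd: "c x = d x" if "1 \<le> x" "x \<le> m" for x using that by (simp add: c_def)
  have im: "c ` {1..m} = {1..k}"
  proof (intro equalityI subsetI)
    fix j assume "j \<in> c ` {1..m}"
    then obtain x where x: "x \<in> {1..m}" "j = d x" using cd by auto
    then have xn: "x \<in> {1..n}" using mn by auto
    then show "j \<in> {1..k}" using staircasesD(3)[OF d xn] D'[OF xn] x by auto
  next
    fix j assume j: "j \<in> {1..k}"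
    then obtain x where x: "x \<in> {1..n}" "d x = j" using staircasesD(5)[OF d, of j] by auto
    then have "x \<in> {1..m}" using D'[OF x(1)] j by auto
    then show "j \<in> c ` {1..m}" using cd x by force
  qed
  have "mono_on {1..m} c"
    by (rule mono_onI) (use staircasesD(2)[OF d] cd mn in auto)
  moreover have "c \<in> {1..m} \<rightarrow>\<^sub>E {1..k}"
  proof (rule PiE_I)
    show "c x \<in> {1..k}" if "x \<in> {1..m}" for x using im that by blast
  qed (auto simp: c_def)
  ultimately have cm: "c \<in> staircases m k" unfolding staircases_def using im by blast
  have "d = extend_staircase n k m c"
  proof
    fix x
    show "d x = extend_staircase n k m c x"
    proof (cases "x \<in> {1..n}")
      case True
      have "d x \<in> {1..Suc k}" by (rule staircasesD(3)[OF d True])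
      then show ?thesis using True D'[OF True] cd[of x] by (auto simp: extend_staircase_def)
    next
      case False
      then show ?thesis using staircasesD(6)[OF d False] by (auto simp: extend_staircase_def)
    qed
  qed
  then show thesis using that mn cm by blast
qed

lemma extend_staircase_inj:
  assumes c: "c \<in> staircases m k" and m: "m < n" and d: "d \<in> staircases l k" and l: "l < n"
    and eq: "extend_staircase n k m c = extend_staircase n k l d"
  shows "m = l \<and> c = d"
proof -
  have "{Suc m..n} = {Suc l..n}"
    using fibre_extend_staircase(2)[OF c m] fibre_extend_staircase(2)[OF d l] eq by metis
  then have ml: "m = l" using m l by auto
  have "c = d"
  proof
    fix x
    show "c x = d x"
    proof (cases "x \<in> {1..m}")
      case True
      then show ?thesis using fun_cong[OF eq, of x] m ml by (simp add: extend_staircase_def)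
    next
      case False
      then show ?thesis using staircasesD(6)[OF c, of x] staircasesD(6)[OF d, of x] ml by simp
    qed
  qed
  then show ?thesis using ml by blast
qed

text \<open>The coefficient sums over all ways to cut \<open>n\<close> positions into \<open>k\<close> intervals. Cutting off the last interval
turns the recursion on \<open>k\<close> into multiplication by the series.\<close>

lemma fact_series_power_nth:
  "fps_nth (fact_series ^ k) n =
     (\<Sum>c\<in>staircases n k. \<Prod>j\<in>{1..k}. fact (card (fibre n c j)))"
proof (induction k arbitrary: n)
  case 0
  show ?case
  proof (cases "n = 0")
    case True
    have "staircases 0 0 = {\<lambda>_. undefined}" by (auto simp: staircases_def mono_on_def)
    then show ?thesis using True by simp
  next
    case False
    have "staircases n 0 = {}" using False by (auto simp: staircases_def)
    then show ?thesis using False by simp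
  qed
next
  case (Suc k)
  let ?w = "\<lambda>n k c. (\<Prod>j\<in>{1..k}. fact (card (fibre n c j)) :: rat)"
  let ?S = "SIGMA m:{..<n}. staircases m k"
  have "fps_nth (fact_series ^ Suc k) n
      = (\<Sum>m=0..n. fps_nth (fact_series ^ k) m * fps_nth fact_series (n - m))"
    by (simp only: power_Suc2 fps_mult_nth)
  also have "\<dots> = (\<Sum>m<n. fps_nth (fact_series ^ k) m * fact (n - m))"
  proof (rule sum.mono_neutral_cong_right)
    show "\<forall>i\<in>{0..n} - {..<n}. fps_nth (fact_series ^ k) i * fps_nth fact_series (n - i) = 0"
      by (auto simp: fact_series_nth)
  qed (auto simp: fact_series_nth)
  also have "\<dots> = (\<Sum>m<n. \<Sum>c\<in>staircases m k. ?w m k c * fact (n - m))"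
    by (simp only: Suc.IH sum_distrib_right)
  also have "\<dots> = (\<Sum>(m, c)\<in>?S. ?w m k c * fact (n - m))"
    by (rule sum.Sigma) (simp_all add: finite_staircases)
  also have "\<dots> = (\<Sum>(m, c)\<in>?S. ?w n (Suc k) (extend_staircase n k m c))"
  proof (rule sum.cong[OF refl])
    fix mc assume "mc \<in> ?S"
    then obtain m c where mc: "mc = (m, c)" and mn: "m < n" and c: "c \<in> staircases m k" by auto
    have "?w n (Suc k) (extend_staircase n k m c)
        = ?w n k (extend_staircase n k m c) * fact (card (fibre n (extend_staircase n k m c) (Suc k)))"
      by (simp add: prod.nat_ivl_Suc')
    also have "?w n k (extend_staircase n k m c) = ?w m k c"
      by (rule prod.cong[OF refl]) (simp only: fibre_extend_staircase(1)[OF c mn])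
    also have "fact (card (fibre n (extend_staircase n k m c) (Suc k))) = (fact (n - m) :: rat)"
      by (simp add: fibre_extend_staircase(2)[OF c mn])
    finally show "(case mc of (m, c) \<Rightarrow> ?w m k c * fact (n - m))
        = (case mc of (m, c) \<Rightarrow> ?w n (Suc k) (extend_staircase n k m c))"
      by (simp add: mc)
  qed
  also have "\<dots> = sum (?w n (Suc k)) (staircases n (Suc k))"
  proof -
    have "bij_betw (\<lambda>(m, c). extend_staircase n k m c) ?S (staircases n (Suc k))"
    proof (rule bij_betw_imageI)
      show "inj_on (\<lambda>(m, c). extend_staircase n k m c) ?S"
      proof (rule inj_onI)
        fix u v assume u: "u \<in> ?S" and v: "v \<in> ?S"
          and eq: "(\<lambda>(m, c). extend_staircase n k m c) u = (\<lambda>(m, c). extend_staircase n k m c) v"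
        obtain m c where mc: "u = (m, c)" "m < n" "c \<in> staircases m k" using u by auto
        obtain l d where ld: "v = (l, d)" "l < n" "d \<in> staircases l k" using v by auto
        show "u = v"
          using extend_staircase_inj[OF mc(3,2) ld(3,2)] eq mc(1) ld(1) by simp
      qed
      show "(\<lambda>(m, c). extend_staircase n k m c) ` ?S = staircases n (Suc k)"
      proof (intro equalityI subsetI)
        fix d assume "d \<in> (\<lambda>(m, c). extend_staircase n k m c) ` ?S"
        then show "d \<in> staircases n (Suc k)" using extend_staircase_mem by auto
      next
        fix d assume "d \<in> staircases n (Suc k)"
        then obtain m c where "m < n" "c \<in> staircases m k" "d = extend_staircase n k m c"
          by (rule restrict_staircase)
        then show "d \<in> (\<lambda>(m, c). extend_staircase n k m c) ` ?S"
          by (intro image_eqI[of _ _ "(m, c)"]) auto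
      qed
    qed
    then show ?thesis by (simp add: sum.reindex_bij_betw[symmetric] case_prod_unfold)
  qed
  finally show ?case .
qed

section \<open>Direct sums and skew sums\<close>

definition indecomposable :: "nat \<Rightarrow> (nat \<Rightarrow> nat) \<Rightarrow> bool" where
  "indecomposable n p \<longleftrightarrow> p permutes {1..n} \<and> (\<forall>m\<in>{1..<n}. p ` {1..m} \<noteq> {1..m})"

definition indec_series :: "rat fps" where
  "indec_series = Abs_fps (\<lambda>n. if n = 0 then 0 else of_nat (card {p. indecomposable n p}))"

lemma finite_permutations_filter [simp]: "finite {p. p permutes {Suc 0..n} \<and> P p}"
  by (rule finite_subset[OF _ finite_permutations[of "{Suc 0..n}"]]) auto

text \<open>Here \<open>m\<close> is the length of the first summand. The permutation restricted to \<open>{1..m}\<close> is indecomposable, and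
the rest is arbitrary.\<close>

lemma card_first_component:
  assumes m: "m \<in> {1..n}"
  shows "card {p. p permutes {1..n} \<and> p ` {1..m} = {1..m} \<and> (\<forall>l\<in>{1..<m}. p ` {1..l} \<noteq> {1..l})}
       = card {p. indecomposable m p} * fact (n - m)" (is "card ?P = _")
proof -
  let ?Q = "{p. indecomposable m p} \<times> {q. q permutes {Suc m..n}}"
  have "bij_betw (\<lambda>(a, b). a \<circ> b) ?Q ?P"
  proof (rule bij_betw_imageI)
    have comp: "(a \<circ> b) x = (if x \<in> {1..m} then a x else b x)"
      if a: "indecomposable m a" and b: "b permutes {Suc m..n}" for a b x
    proof (cases "x \<in> {1..m}")
      case True
      then show ?thesis using permutes_not_in[OF b, of x] by simp
    next
      case False
      have ap: "a permutes {1..m}" using a by (simp add: indecomposable_def)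
      have "b x \<notin> {1..m}"
        using False permutes_in_image[OF b, of x] permutes_not_in[OF b, of x]
        by (cases "x \<in> {Suc m..n}") auto
      then show ?thesis using permutes_not_in[OF ap, of "b x"] False by auto
    qed
    show "inj_on (\<lambda>(a, b). a \<circ> b) ?Q"
    proof (rule inj_onI)
      fix u v assume u: "u \<in> ?Q" and v: "v \<in> ?Q"
        and uv: "(\<lambda>(a, b). a \<circ> b) u = (\<lambda>(a, b). a \<circ> b) v"
      obtain a b where ab: "u = (a, b)" and a: "indecomposable m a" and b: "b permutes {Suc m..n}"
        using u by auto
      obtain a' b' where ab': "v = (a', b')" and a': "indecomposable m a'"
        and b': "b' permutes {Suc m..n}" using v by auto
      have eq: "a \<circ> b = a' \<circ> b'" using uv ab ab' by simp
      have ap: "a permutes {1..m}" "a' permutes {1..m}" using a a' by (simp_all add: indecomposable_def)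
      have eq': "(if x \<in> {1..m} then a x else b x) = (if x \<in> {1..m} then a' x else b' x)" for x
        using comp[OF a b, of x] comp[OF a' b', of x] eq by simp
      have "a x = a' x" for x
        using eq'[of x] permutes_not_in[OF ap(1), of x] permutes_not_in[OF ap(2), of x]
        by (cases "x \<in> {1..m}") auto
      moreover have "b x = b' x" for x
        using eq'[of x] permutes_not_in[OF b, of x] permutes_not_in[OF b', of x]
        by (cases "x \<in> {1..m}") auto
      ultimately show "u = v" unfolding ab ab' by auto
    qed
    show "(\<lambda>(a, b). a \<circ> b) ` ?Q = ?P"
    proof (intro equalityI subsetI)
      fix p assume "p \<in> (\<lambda>(a, b). a \<circ> b) ` ?Q"
      then obtain a b where a: "indecomposable m a" and b: "b permutes {Suc m..n}" and p: "p = a \<circ> b"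
        by auto
      have ap: "a permutes {1..m}" using a by (simp add: indecomposable_def)
      have "a permutes {1..n}" "b permutes {1..n}"
        using permutes_subset[OF ap, of "{1..n}"] permutes_subset[OF b, of "{1..n}"] m by auto
      then have "p permutes {1..n}" unfolding p by (intro permutes_compose)
      moreover have im: "p ` {1..l} = a ` {1..l}" if "l \<le> m" for l
        by (rule image_cong[OF refl]) (use comp[OF a b] p that in auto)
      have "p ` {1..m} = {1..m}" using im[of m] permutes_image[OF ap] by simp
      moreover have "p ` {1..l} \<noteq> {1..l}" if "l \<in> {1..<m}" for l
        using im[of l] a that by (simp add: indecomposable_def)
      ultimately show "p \<in> ?P" by blast
    next
      fix p assume "p \<in> ?P"
      then have pp: "p permutes {1..n}" and pm: "p ` {1..m} = {1..m}"
        and pl: "\<And>l. l \<in> {1..<m} \<Longrightarrow> p ` {1..l} \<noteq> {1..l}" by blast+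
      define a where "a x = (if x \<in> {1..m} then p x else x)" for x
      define b where "b x = (if x \<in> {Suc m..n} then p x else x)" for x
      have inj: "inj_on p S" for S using permutes_inj_on[OF pp] .
      have ap: "a permutes {1..m}"
      proof (rule inj_imp_permutes)
        show "inj_on a {1..m}" using inj_on_cong[of "{1..m}" a p] inj by (simp add: a_def)
        show "a x \<in> {1..m}" if "x \<in> {1..m}" for x using that pm by (simp only: a_def if_True) blast
        show "a x = x" if "x \<notin> {1..m}" for x unfolding a_def using that by (rule if_not_P)
      qed simp
      have "{Suc m..n} = {1..n} - {1..m}" using m by auto
      then have pb: "p ` {Suc m..n} = {Suc m..n}" using permutes_image_diff[OF pp] pm by metis
      have bp: "b permutes {Suc m..n}"
      proof (rule inj_imp_permutes)
        show "inj_on b {Suc m..n}" using inj_on_cong[of "{Suc m..n}" b p] inj by (simp add: b_def)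
        show "b x \<in> {Suc m..n}" if "x \<in> {Suc m..n}" for x
          using that pb by (simp only: b_def if_True) blast
        show "b x = x" if "x \<notin> {Suc m..n}" for x unfolding b_def using that by (rule if_not_P)
      qed simp
      have "a ` {1..l} = p ` {1..l}" if "l \<le> m" for l
        by (rule image_cong[OF refl]) (use that in \<open>simp add: a_def\<close>)
      then have ai: "indecomposable m a" unfolding indecomposable_def using ap pl by simp
      have "p = a \<circ> b"
      proof
        fix x
        consider "x \<in> {1..m}" | "x \<in> {Suc m..n}" | "x \<notin> {1..n}" by fastforce
        then show "p x = (a \<circ> b) x"
        proof cases
          case 3
          then show ?thesis unfolding comp[OF ai bp] using m permutes_not_in[OF pp 3] by (auto simp: b_def)
        qed (unfold comp[OF ai bp], auto simp: a_def b_def)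
      qed
      then show "p \<in> (\<lambda>(a, b). a \<circ> b) ` ?Q" using ai bp by (intro image_eqI[of _ _ "(a, b)"]) auto
    qed
  qed
  then have "card ?P = card ?Q" by (rule bij_betw_same_card[symmetric])
  also have "\<dots> = card {p. indecomposable m p} * card {q. q permutes {Suc m..n}}"
    by (rule card_cartesian_product)
  also have "card {q. q permutes {Suc m..n}} = fact (n - m)"
    by (rule card_permutations) simp_all
  finally show ?thesis .
qed

lemma indec_convolution:
  assumes n: "1 \<le> n"
  shows "(\<Sum>m=1..n. card {p. indecomposable m p} * fact (n - m)) = fact n"
proof -
  let ?P = "\<lambda>m. {p. p permutes {1..n} \<and> p ` {1..m} = {1..m} \<and> (\<forall>l\<in>{1..<m}. p ` {1..l} \<noteq> {1..l})}"
  have "{p. p permutes {1..n}} = (\<Union>m\<in>{1..n}. ?P m)"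
  proof (intro equalityI subsetI)
    fix p assume "p \<in> {p. p permutes {1..n}}"
    then have p: "p permutes {1..n}" by simp
    let ?Q = "\<lambda>m. 1 \<le> m \<and> p ` {1..m} = {1..m}"
    define m where "m = (LEAST m. ?Q m)"
    have Qn: "?Q n" using n permutes_image[OF p] by simp
    have "?Q m" unfolding m_def by (rule LeastI[of ?Q, OF Qn])
    moreover have "m \<le> n" unfolding m_def by (rule Least_le[of ?Q, OF Qn])
    moreover have "\<not> ?Q l" if "l < m" for l using not_less_Least[of l ?Q] that unfolding m_def .
    ultimately have "m \<in> {1..n}" "p \<in> ?P m" using p by auto
    then show "p \<in> (\<Union>m\<in>{1..n}. ?P m)" by (rule UN_I)
  qed auto
  then have "fact n = card (\<Union>m\<in>{1..n}. ?P m)" using card_permutations[of "{1..n}" n] by simp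
  also have "\<dots> = (\<Sum>m=1..n. card (?P m))"
  proof (rule card_UN_disjoint)
    show "\<forall>i\<in>{1..n}. \<forall>j\<in>{1..n}. i \<noteq> j \<longrightarrow> ?P i \<inter> ?P j = {}"
    proof (intro ballI impI)
      fix i j assume ij: "i \<in> {1..n}" "j \<in> {1..n}" "i \<noteq> j"
      have "i \<in> {1..<j} \<or> j \<in> {1..<i}" using ij by auto
      then show "?P i \<inter> ?P j = {}" by blast
    qed
  qed simp_all
  also have "\<dots> = (\<Sum>m=1..n. card {p. indecomposable m p} * fact (n - m))"
    by (rule sum.cong[OF refl card_first_component])
  finally show ?thesis by simp
qed

lemma indec_series_eq: "indec_series * (1 + fact_series) = fact_series"
proof (rule fps_ext)
  fix n
  show "fps_nth (indec_series * (1 + fact_series)) n = fps_nth fact_series n"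
  proof (cases "n = 0")
    case True
    then show ?thesis by (simp add: indec_series_def fact_series_nth)
  next
    case False
    have "fps_nth (indec_series * (1 + fact_series)) n
        = (\<Sum>m=0..n. fps_nth indec_series m * fact (n - m))"
      unfolding fps_mult_nth by (rule sum.cong) (auto simp: fact_series_nth)
    also have "\<dots> = (\<Sum>m=1..n. of_nat (card {p. indecomposable m p} * fact (n - m)))"
      by (rule sum.mono_neutral_cong_right) (auto simp: indec_series_def)
    also have "\<dots> = of_nat (fact n)"
      using indec_convolution[of n] False by (simp only: of_nat_sum[symmetric])
    finally show ?thesis using False by (simp add: fact_series_nth)
  qed
qed

text \<open>Extended by the identity, so that it is a permutation in the sense of \<^const>\<open>permutes\<close>.\<close>

definition reversal :: "nat \<Rightarrow> nat \<Rightarrow> nat" where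
  "reversal n x = (if x \<in> {1..n} then Suc n - x else x)"

lemma reversal_reversal: "reversal n (reversal n x) = x"
  by (auto simp: reversal_def)

lemma reversal_permutes: "reversal n permutes {1..n}"
proof (rule inj_imp_permutes)
  show "inj_on (reversal n) {1..n}" by (rule inj_onI) (metis reversal_reversal)
qed (auto simp: reversal_def)

lemma reversal_image:
  assumes "m \<le> n"
  shows "reversal n ` {1..m} = {Suc (n - m)..n}"
proof (intro equalityI subsetI)
  fix y assume y: "y \<in> {Suc (n - m)..n}"
  then have "y = reversal n (reversal n y)" "reversal n y \<in> {1..m}"
    using assms by (auto simp: reversal_def)
  then show "y \<in> reversal n ` {1..m}" by blast
qed (use assms in \<open>auto simp: reversal_def\<close>)

lemma reversal_comp_image_iff:
  assumes "m \<le> n"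
  shows "(reversal n \<circ> p) ` {1..m} = {1..m} \<longleftrightarrow> p ` {1..m} = {Suc (n - m)..n}"
proof -
  have "(reversal n \<circ> p) ` {1..m} = {1..m} \<longleftrightarrow> reversal n ` (p ` {1..m}) = {1..m}"
    by (simp only: image_comp)
  also have "\<dots> \<longleftrightarrow> reversal n ` reversal n ` (p ` {1..m}) = reversal n ` {1..m}"
    by (simp only: inj_image_eq_iff[OF permutes_inj[OF reversal_permutes]])
  also have "\<dots> \<longleftrightarrow> p ` {1..m} = {Suc (n - m)..n}"
    by (simp add: image_image reversal_reversal reversal_image[OF assms, simplified])
  finally show ?thesis .
qed

text \<open>Of two complementary blocks the one containing position 1 is an initial segment, and so is one of the
two sets of values: the same block's, or the other block's.\<close>

lemma splits_iff:
  assumes p: "p permutes {1..n}"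
  shows "splits n p \<longleftrightarrow>
    (\<exists>m\<in>{1..<n}. p ` {1..m} = {1..m}) \<or> (\<exists>m\<in>{1..<n}. p ` {1..m} = {Suc (n - m)..n})"
    (is "_ \<longleftrightarrow> ?R")
proof
  note iff = perm_block_iff[OF p]
  assume "splits n p"
  then obtain B0 where B0: "perm_block n p B0" "perm_block n p ({1..n} - B0)"
    unfolding splits_def by blast
  have "\<exists>B. perm_block n p B \<and> perm_block n p ({1..n} - B) \<and> 1 \<in> B"
  proof (cases "1 \<in> B0")
    case False
    have "B0 \<noteq> {}" and sub: "B0 \<subseteq> {1..n}" using B0(1) unfolding iff by blast+
    then have "1 \<in> {1..n} - B0" using False by auto
    moreover have "{1..n} - ({1..n} - B0) = B0" using sub by blast
    ultimately show ?thesis using B0 by metis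
  qed (use B0 in blast)
  then obtain B where B: "perm_block n p B" "perm_block n p ({1..n} - B)" "1 \<in> B" by blast
  have sub: "B \<subseteq> {1..n}" and cB: "ord_convex B" and pB: "ord_convex (p ` B)"
    using B(1) unfolding iff by blast+
  have pB': "ord_convex ({1..n} - p ` B)" and ne: "{1..n} - B \<noteq> {}"
    using B(2) unfolding iff permutes_image_diff[OF p] by blast+
  define m where "m = card B"
  have Bm: "B = {1..m}" unfolding m_def by (rule ord_convex_initial[OF cB sub B(3)])
  have m: "m \<in> {1..<n}" using B(3) ne sub unfolding Bm by auto
  have psub: "p ` B \<subseteq> {1..n}" by (rule permutes_image_subset[OF p sub])
  have card: "card (p ` B) = m" unfolding m_def by (rule card_image[OF permutes_inj_on[OF p]])
  show ?R
  proof (cases "1 \<in> p ` B")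
    case True
    have "p ` B = {1..m}" using ord_convex_initial[OF pB psub True] card by simp
    then show ?thesis using m Bm by blast
  next
    case False
    have fin: "finite (p ` B)" using psub finite_subset by blast
    have "1 \<in> {1..n} - p ` B" using False m by simp
    from ord_convex_initial[OF pB' _ this]
    have "{1..n} - p ` B = {1..card ({1..n} - p ` B)}" by blast
    also have "card ({1..n} - p ` B) = n - m"
      using card_Diff_subset[OF fin psub] card by simp
    finally have "{1..n} - p ` B = {1..n - m}" .
    then have "p ` B = {1..n} - {1..n - m}" using psub by blast
    also have "\<dots> = {Suc (n - m)..n}" by auto
    finally show ?thesis using m Bm by blast
  qed
next
  note iff = perm_block_iff[OF p]
  assume ?R
  then obtain m where m: "m \<in> {1..<n}" and im: "p ` {1..m} = {1..m} \<or> p ` {1..m} = {Suc (n - m)..n}"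
    by blast
  have c1: "{1..n} - {1..m} = {Suc m..n}" and c2: "{1..n} - {Suc (n - m)..n} = {1..n - m}"
    using m by auto
  have "p ` {Suc m..n} = {1..n} - p ` {1..m}" using permutes_image_diff[OF p, of "{1..m}"] c1 by simp
  then have "ord_convex (p ` {1..m})" "ord_convex (p ` {Suc m..n})"
    using im c1 c2 ord_convex_atLeastAtMost by metis+
  then have "perm_block n p {1..m}" "perm_block n p ({1..n} - {1..m})"
    unfolding iff c1 using m ord_convex_atLeastAtMost by auto
  then show "splits n p" unfolding splits_def by blast
qed

lemma not_both_decomposable:
  assumes m: "m \<in> {1..<n}" "p ` {1..m} = {1..m}" and l: "l \<in> {1..<n}" "p ` {1..l} = {Suc (n - l)..n}"
  shows False
proof (cases "m \<le> l")
  case True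
  then have "p ` {1..m} \<subseteq> p ` {1..l}" by (intro image_mono) auto
  then have "1 \<in> {Suc (n - l)..n}" using m l by auto
  then show False using l by simp
next
  case False
  then have "p ` {1..l} \<subseteq> p ` {1..m}" by (intro image_mono) auto
  then have "n \<in> {1..m}" using m l by auto
  then show False using m by simp
qed

text \<open>Reversing values exchanges direct and skew sums, and no permutation is both; so twice the number of
decomposable permutations counts the ones that split.\<close>

lemma card_splits:
  "card {p. p permutes {1..n} \<and> splits n p} + 2 * card {p. indecomposable n p} = 2 * fact n"
proof -
  let ?D = "{p. p permutes {1..n} \<and> \<not> indecomposable n p}"
  let ?E = "{p. p permutes {1..n} \<and> \<not> indecomposable n (reversal n \<circ> p)}"
  note rp = reversal_permutes[of n]
  have D: "\<not> indecomposable n p \<longleftrightarrow> (\<exists>m\<in>{1..<n}. p ` {1..m} = {1..m})" if "p permutes {1..n}" for p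
    using that by (auto simp: indecomposable_def)
  have E: "\<not> indecomposable n (reversal n \<circ> p) \<longleftrightarrow> (\<exists>m\<in>{1..<n}. p ` {1..m} = {Suc (n - m)..n})"
    if "p permutes {1..n}" for p
    unfolding D[OF permutes_compose[OF that rp]] by (rule bex_cong[OF refl reversal_comp_image_iff]) simp
  have "splits n p \<longleftrightarrow> \<not> indecomposable n p \<or> \<not> indecomposable n (reversal n \<circ> p)"
    if "p permutes {1..n}" for p
    unfolding splits_iff[OF that] D[OF that] E[OF that] by (rule refl)
  then have "{p. p permutes {1..n} \<and> splits n p} = ?D \<union> ?E" by blast
  moreover have "indecomposable n p \<or> indecomposable n (reversal n \<circ> p)" if p: "p permutes {1..n}" for p
  proof (rule ccontr)
    assume "\<not> ?thesis"
    then obtain m l where "m \<in> {1..<n}" "p ` {1..m} = {1..m}"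
      "l \<in> {1..<n}" "p ` {1..l} = {Suc (n - l)..n}"
      using D[OF p] E[OF p] by meson
    then show False by (rule not_both_decomposable)
  qed
  then have "?D \<inter> ?E = {}" by blast
  ultimately have split: "card {p. p permutes {1..n} \<and> splits n p} = card ?D + card ?E"
    by (simp add: card_Un_disjoint)
  have "bij_betw (\<lambda>p. reversal n \<circ> p) ?E ?D"
  proof (rule bij_betw_byWitness[where f' = "\<lambda>p. reversal n \<circ> p"])
    have rr: "reversal n \<circ> (reversal n \<circ> p) = p" for p :: "nat \<Rightarrow> nat" by (simp add: fun_eq_iff reversal_reversal)
    show "\<forall>p\<in>?E. reversal n \<circ> (reversal n \<circ> p) = p" "\<forall>p\<in>?D. reversal n \<circ> (reversal n \<circ> p) = p"
      using rr by blast+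
    show "(\<lambda>p. reversal n \<circ> p) ` ?E \<subseteq> ?D" using permutes_compose[OF _ rp] by blast
    show "(\<lambda>p. reversal n \<circ> p) ` ?D \<subseteq> ?E" using permutes_compose[OF _ rp] rr by auto
  qed
  then have "card ?E = card ?D" by (rule bij_betw_same_card)
  moreover have "card ?D + card {p. indecomposable n p} = fact n"
  proof -
    have "{p. p permutes {1..n}} = ?D \<union> {p. indecomposable n p}" by (auto simp: indecomposable_def)
    moreover have "finite {p. indecomposable n p}" by (simp add: indecomposable_def)
    ultimately have "card {p. p permutes {1..n}} = card ?D + card {p. indecomposable n p}"
      by (simp add: card_Un_disjoint disjoint_iff)
    then show ?thesis using card_permutations[of "{1..n}" n] by simp
  qed
  ultimately show ?thesis using split by simp
qed

section \<open>The functional equation\<close>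

lemma staircase_le: "c \<in> staircases n k \<Longrightarrow> k \<le> n"
  using card_image_le[of "{1..n}" c] by (simp only: staircasesD(1)) simp

text \<open>The inflation classes over all simple permutations of length at least 4 and all partitions are pairwise
disjoint and exhaust the permutations that do not split, so their sizes add up.\<close>

lemma card_unsplit:
  assumes n: "2 \<le> n"
  shows "card {p. p permutes {1..n} \<and> \<not> splits n p}
    = (\<Sum>k=4..n. num_simple k * (\<Sum>c\<in>staircases n k. \<Prod>j\<in>{1..k}. fact (card (fibre n c j))))"
proof -
  let ?w = "\<lambda>k c. (\<Prod>j\<in>{1..k}. fact (card (fibre n c j))) :: nat"
  let ?T = "SIGMA k:{4..n}. {s. simple_perm k s} \<times> staircases n k"
  let ?I = "\<lambda>(k, s, c). inflations n s c"
  have finS: "finite {s. simple_perm k s}" for k unfolding simple_perm_def by simp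
  have eq: "{p. p permutes {1..n} \<and> \<not> splits n p} = (\<Union>t\<in>?T. ?I t)"
  proof (intro equalityI subsetI)
    fix p assume "p \<in> {p. p permutes {1..n} \<and> \<not> splits n p}"
    then have p: "p permutes {1..n}" "\<not> splits n p" by auto
    obtain k s c where *: "4 \<le> k" "simple_perm k s" "c \<in> staircases n k" "p \<in> inflations n s c"
      by (rule inflation_exists[OF p(1) n p(2)])
    then have "(k, s, c) \<in> ?T" using staircase_le by auto
    moreover have "p \<in> ?I (k, s, c)" using * by simp
    ultimately show "p \<in> (\<Union>t\<in>?T. ?I t)" by (rule UN_I)
  next
    fix p assume "p \<in> (\<Union>t\<in>?T. ?I t)"
    then obtain k s c where k: "4 \<le> k" and s: "simple_perm k s" and c: "c \<in> staircases n k"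
      and p: "p \<in> inflations n s c" by auto
    have "\<not> splits n p" by (rule inflation_not_splits[OF c s _ p]) (use k in simp)
    then show "p \<in> {p. p permutes {1..n} \<and> \<not> splits n p}" using inflationsD(1)[OF p] by simp
  qed
  have "card (\<Union>t\<in>?T. ?I t) = (\<Sum>t\<in>?T. card (?I t))"
  proof (rule card_UN_disjoint)
    show "finite ?T" using finS finite_staircases by (intro finite_SigmaI finite_cartesian_product) auto
    have "finite (inflations n s c)" for s c unfolding inflations_def order_compatible_def by simp
    then show "\<forall>t\<in>?T. finite (?I t)" by auto
    show "\<forall>t\<in>?T. \<forall>u\<in>?T. t \<noteq> u \<longrightarrow> ?I t \<inter> ?I u = {}"
    proof (intro ballI impI)
      fix t u assume t: "t \<in> ?T" and u: "u \<in> ?T" and ne: "t \<noteq> u"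
      obtain k s c where tt: "t = (k, s, c)" "4 \<le> k" "simple_perm k s" "c \<in> staircases n k"
        using t by auto
      obtain l r d where uu: "u = (l, r, d)" "4 \<le> l" "simple_perm l r" "d \<in> staircases n l"
        using u by auto
      have "p \<notin> inflations n r d" if "p \<in> inflations n s c" for p
        using inflation_unique[OF tt(4,3) _ that uu(4,3)] tt(1,2) uu(1,2) ne by auto
      then show "?I t \<inter> ?I u = {}" using tt(1) uu(1) by auto
    qed
  qed
  also have "\<dots> = (\<Sum>t\<in>?T. (\<lambda>(k, s, c). ?w k c) t)"
  proof (rule sum.cong[OF refl])
    fix t assume "t \<in> ?T"
    then obtain k s c where t: "t = (k, s, c)" "simple_perm k s" "c \<in> staircases n k" by auto
    show "card (?I t) = (\<lambda>(k, s, c). ?w k c) t"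
      using card_inflations[OF t(3) simple_permD(1)[OF t(2)]] t(1) by simp
  qed
  also have "\<dots> = (\<Sum>k=4..n. \<Sum>(s, c)\<in>{s. simple_perm k s} \<times> staircases n k. ?w k c)"
    by (subst sum.Sigma) (auto intro!: finite_cartesian_product finS finite_staircases)
  also have "\<dots> = (\<Sum>k=4..n. num_simple k * (\<Sum>c\<in>staircases n k. ?w k c))"
    by (simp add: sum.cartesian_product[symmetric] num_simple_def)
  finally show ?thesis unfolding eq .
qed

lemma simple_compose_fact_nth:
  "fps_nth (simple_series oo fact_series) n =
    of_nat (\<Sum>k=4..n. num_simple k * (\<Sum>c\<in>staircases n k. \<Prod>j\<in>{1..k}. fact (card (fibre n c j))))"
proof -
  have "fps_nth (simple_series oo fact_series) n
      = (\<Sum>k=0..n. fps_nth simple_series k * fps_nth (fact_series ^ k) n)"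
    by (rule fps_compose_nth)
  also have "\<dots> = (\<Sum>k=4..n. of_nat (num_simple k) * fps_nth (fact_series ^ k) n)"
    by (rule sum.mono_neutral_cong_right) (auto simp: simple_series_def)
  finally show ?thesis by (simp add: fact_series_power_nth)
qed

text \<open>The summands count the permutation of length 1, the direct and the skew sums, and the inflations of
simple permutations of length at least 4.\<close>

lemma fact_series_decomposition:
  "fact_series = fps_X + 2 * (fact_series - indec_series) + (simple_series oo fact_series)"
proof (rule fps_ext)
  fix n
  let ?a = "card {p. indecomposable n p}"
  have two: "fps_nth (2 * f) n = 2 * fps_nth f n" for f :: "rat fps"
    by (simp only: mult_2 fps_add_nth)
  consider "n = 0" | "n = 1" | "2 \<le> n" by linarith
  then show "fps_nth fact_series n
      = fps_nth (fps_X + 2 * (fact_series - indec_series) + (simple_series oo fact_series)) n"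
  proof cases
    case 1
    then show ?thesis
      unfolding fps_add_nth two fps_sub_nth simple_compose_fact_nth
      by (simp add: fact_series_nth indec_series_def)
  next
    case 2
    then have "?a = 1" using indec_convolution[of 1] by simp
    then show ?thesis
      unfolding fps_add_nth two fps_sub_nth simple_compose_fact_nth
      using 2 by (simp add: fact_series_nth indec_series_def)
  next
    case 3
    let ?S = "card {p. p permutes {1..n} \<and> splits n p}"
    let ?U = "card {p. p permutes {1..n} \<and> \<not> splits n p}"
    have "{p. p permutes {1..n}} =
        {p. p permutes {1..n} \<and> splits n p} \<union> {p. p permutes {1..n} \<and> \<not> splits n p}" by blast
    then have "card {p. p permutes {1..n}} = ?S + ?U"
      by (simp only:) (rule card_Un_disjoint, auto)
    then have "?S + ?U = fact n" using card_permutations[of "{1..n}" n] by simp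
    then have total: "of_nat ?S + of_nat ?U = (fact n :: rat)"
      by (metis of_nat_add of_nat_fact)
    have "of_nat ?S + 2 * of_nat ?a = (2 * fact n :: rat)"
      using arg_cong[OF card_splits[of n], of "of_nat :: nat \<Rightarrow> rat"] by simp
    then have "fact n = 2 * (fact n - of_nat ?a) + (of_nat ?U :: rat)"
      using total by (simp add: algebra_simps)
    then show ?thesis
      unfolding fps_add_nth two fps_sub_nth simple_compose_fact_nth card_unsplit[OF 3, symmetric]
      using 3 by (simp add: fact_series_nth indec_series_def)
  qed
qed

theorem mainTheorem2:
  shows "simple_series = fps_X - 2 * fps_X ^ 2 / (1 + fps_X) - fps_inv fact_series"
proof -
  let ?G = "fps_inv fact_series"
  let ?A = "indec_series oo ?G"
  have G0: "fps_nth ?G 0 = 0" by (rule fact_series_inv(1))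
  have FG: "fact_series oo ?G = fps_X" by (rule fact_series_inv(2))
  have SG: "(simple_series oo fact_series) oo ?G = simple_series"
  proof -
    have "simple_series oo (fact_series oo ?G) = (simple_series oo fact_series) oo ?G"
      by (rule fps_compose_assoc[OF G0]) (simp add: fact_series_nth)
    then show ?thesis by (simp add: FG)
  qed
  have two: "2 * f = f + f" for f :: "rat fps" by (rule mult_2)
  have "fact_series oo ?G =
      (fps_X + 2 * (fact_series - indec_series) + (simple_series oo fact_series)) oo ?G"
    using fact_series_decomposition by metis
  also have "\<dots> = ?G + 2 * (fps_X - ?A) + simple_series"
    by (simp only: two fps_compose_add_distrib fps_compose_sub_distrib FG SG
        fps_X_fps_compose_startby0[OF G0])
  finally have main: "fps_X = ?G + 2 * (fps_X - ?A) + simple_series" by (simp only: FG)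
  have "(indec_series * (1 + fact_series)) oo ?G = fact_series oo ?G"
    by (simp only: indec_series_eq)
  then have A: "?A * (1 + fps_X) = fps_X"
    by (simp only: fps_compose_mult_distrib[OF G0] fps_compose_add_distrib fps_compose_1 FG)
  have nz: "(1 + fps_X :: rat fps) \<noteq> 0"
  proof
    assume "(1 + fps_X :: rat fps) = 0"
    then have "fps_nth (1 + fps_X :: rat fps) 0 = 0" by simp
    then show False by simp
  qed
  have "2 * fps_X ^ 2 = 2 * (fps_X - ?A) * (1 + fps_X)"
  proof -
    have "2 * (fps_X - ?A) * (1 + fps_X) = 2 * (fps_X * (1 + fps_X) - ?A * (1 + fps_X))"
      by (simp only: left_diff_distrib mult.assoc)
    then show ?thesis unfolding A by (simp add: algebra_simps power2_eq_square)
  qed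
  then have "2 * fps_X ^ 2 / (1 + fps_X) = 2 * (fps_X - ?A)"
    using nz by simp
  then show ?thesis using main by (simp add: algebra_simps)
qed

end
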